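(* For every $\varepsilon>0$ there exist $n_0$ and $\delta>0$ such that for every $n\ge n_0$, every graph on $n$ vertices with at most $\delta n^{5/2}$ copies of $C_5$ and at most $\delta n^2$ copies of $C_4$ can be made simultaneously $C_3$-free and $C_5$-free by deleting at most $\varepsilon n^{3/2}$ edges.
   Context: $C_k$ denotes the cycle on $k$ vertices ($C_3$ is the triangle); a copy of $C_k$ in a graph is a subgraph isomorphic to $C_k$. Equivalently: an $n$-vertex graph with $o(n^2)$ copies of $C_4$ and $o(n^{5/2})$ copies of $C_5$ can be made $\{C_3,C_5\}$-free by deleting $o(n^{3/2})$ edges. *)

theory Defs
  imports Complex_Main
begin

definition simple_graph :: "nat \<Rightarrow> nat set set \<Rightarrow> bool" where
  "simple_graph n E \<longleftrightarrow> (\<forall>e\<in>E. \<exists>u v. e = {u, v} \<and> u \<noteq> v \<and> u < n \<and> v < n)"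

definition cycle_edges :: "'a list \<Rightarrow> 'a set set" where
  "cycle_edges xs = {{xs ! i, xs ! ((i + 1) mod length xs)} | i. i < length xs}"

text \<open>The copies of C_k in the graph with edge set E: subgraphs isomorphic to C_k,
  each identified with its edge set (a cycle has no isolated vertices).\<close>
definition cycle_copies :: "nat \<Rightarrow> 'a set set \<Rightarrow> 'a set set set" where
  "cycle_copies k E = {C. C \<subseteq> E \<and> (\<exists>xs. length xs = k \<and> distinct xs \<and> C = cycle_edges xs)}"

definition num_cycle_copies :: "nat \<Rightarrow> 'a set set \<Rightarrow> nat" where
  "num_cycle_copies k E = card (cycle_copies k E)"

definition cycle_free :: "nat \<Rightarrow> 'a set set \<Rightarrow> bool" where
  "cycle_free k E \<longleftrightarrow> cycle_copies k E = {}"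

end

theory Submission
  imports Defs
begin

text \<open>
  Write \<open>s = \<surd>n\<close> and let \<open>f\<close> be the adjacency function. Few 4-cycles means that almost all
  codegrees are at most 1, so \<open>\<Sum> deg\<^sup>2 = O(n\<^sup>2)\<close>, and deleting the edges at vertices of degree above
  \<open>M s\<close> costs little.

  Averaging \<open>f\<close> over the blocks of a vertex partition and truncating at \<open>c / s\<close> is a projection onto a
  convex set, so an energy increment argument gives a strong regularity lemma: partitions \<open>\<P>\<close> and
  \<open>\<Q>\<close> whose truncated averages are \<open>L\<^sup>2\<close>-close and such that no rectangle has noticeably
  fewer edges than the truncated average over \<open>\<Q>\<close> predicts. The lower bound is all that counting needs,
  and the truncation is what keeps the energy bounded in the sparse setting.

  Let \<open>h\<close> be the dense graph where the truncated average over \<open>\<Q>\<close> is at least \<open>c / (2 s)\<close>. A 5-cycle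
  is an edge together with two 2-paths, and 2-path counts are essentially 0/1-valued; hence the edges of
  a 5-cycle can be traded one at a time for edges of \<open>h\<close>. Now discard the pairs in tiny blocks of
  \<open>\<P>\<close>, in sparse blocks, and in blocks where \<open>h\<close> is not almost complete. Every closed walk of
  length 5 in the rest lives in blocks that are almost complete for \<open>h\<close>, hence forces
  \<open>\<Omega>(n\<^sup>2 s)\<close> 5-cycles. Triangles \<open>xyz\<close> are covered by the closed walk \<open>x y z y z\<close>.
\<close>

section \<open>Averages over the atoms of a set system\<close>

text \<open>The cells of the partition of \<open>V\<close> generated by \<open>\<F>\<close>.
  Encoding a partition by a generating set system makes refinement plain inclusion, and cutting by a
  rectangle is just adding its two sides.\<close>

definition atom :: "'a set \<Rightarrow> 'a set set \<Rightarrow> 'a \<Rightarrow> 'a set" where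
  "atom V \<F> x = {y\<in>V. \<forall>S\<in>\<F>. x \<in> S \<longleftrightarrow> y \<in> S}"

definition avg1 :: "'a set \<Rightarrow> 'a set set \<Rightarrow> ('a \<Rightarrow> real) \<Rightarrow> 'a \<Rightarrow> real" where
  "avg1 V \<F> f x = (\<Sum>u\<in>atom V \<F> x. f u) / real (card (atom V \<F> x))"

definition avg :: "'a set \<Rightarrow> 'a set set \<Rightarrow> ('a \<Rightarrow> 'a \<Rightarrow> real) \<Rightarrow> 'a \<Rightarrow> 'a \<Rightarrow> real" where
  "avg V \<F> f x y = avg1 V \<F> (\<lambda>u. avg1 V \<F> (f u) y) x"

text \<open>The value type is general so that the notion covers real functions and predicates on
  pairs alike.\<close>

definition blockwise :: "'a set \<Rightarrow> 'a set set \<Rightarrow> ('a \<Rightarrow> 'a \<Rightarrow> 'b) \<Rightarrow> bool" where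
  "blockwise V \<F> h \<longleftrightarrow>
     (\<forall>x\<in>V. \<forall>y\<in>V. \<forall>u\<in>atom V \<F> x. \<forall>v\<in>atom V \<F> y. h u v = h x y)"

lemma atom_subset: "atom V \<F> x \<subseteq> V"
  by (auto simp: atom_def)

lemma atom_self: "x \<in> V \<Longrightarrow> x \<in> atom V \<F> x"
  by (auto simp: atom_def)

lemma atom_eq: "u \<in> atom V \<F> x \<Longrightarrow> atom V \<F> u = atom V \<F> x"
  by (auto simp: atom_def)

lemma atom_sym: "x \<in> V \<Longrightarrow> u \<in> atom V \<F> x \<Longrightarrow> x \<in> atom V \<F> u"
  by (auto simp: atom_def)

lemma atom_antimono: "\<F> \<subseteq> \<G> \<Longrightarrow> atom V \<G> x \<subseteq> atom V \<F> x"
  by (auto simp: atom_def)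

lemma finite_atom: "finite V \<Longrightarrow> finite (atom V \<F> x)"
  using atom_subset finite_subset by metis

lemma card_atom_pos: "finite V \<Longrightarrow> x \<in> V \<Longrightarrow> 0 < card (atom V \<F> x)"
  using atom_self finite_atom card_gt_0_iff by fastforce

lemma avg1_nonneg: "(\<And>u. u \<in> V \<Longrightarrow> 0 \<le> f u) \<Longrightarrow> 0 \<le> avg1 V \<F> f x"
  unfolding avg1_def by (intro divide_nonneg_nonneg sum_nonneg) (auto simp: atom_def)

lemma blockwise_avg: "blockwise V \<F> (avg V \<F> f)"
  unfolding blockwise_def avg_def by (auto simp: avg1_def atom_eq)

lemma blockwise_mono:
  assumes "blockwise V \<F> h" "\<F> \<subseteq> \<G>"
  shows "blockwise V \<G> h"
  unfolding blockwise_def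
proof (intro ballI)
  fix x y u v assume "x \<in> V" "y \<in> V" "u \<in> atom V \<G> x" "v \<in> atom V \<G> y"
  moreover from this have "u \<in> atom V \<F> x" "v \<in> atom V \<F> y"
    using atom_antimono[OF assms(2)] by blast+
  ultimately show "h u v = h x y" using assms(1) unfolding blockwise_def by blast
qed

lemma blockwise_compose:
  assumes "blockwise V \<F> h"
  shows "blockwise V \<F> (\<lambda>x y. \<phi> (h x y))"
  unfolding blockwise_def
  by (intro ballI arg_cong[of _ _ \<phi>]) (use assms in \<open>unfold blockwise_def, blast\<close>)

lemma avg_eq:
  "avg V \<F> w x y = (\<Sum>u\<in>atom V \<F> x. \<Sum>v\<in>atom V \<F> y. w u v)
     / (real (card (atom V \<F> x)) * real (card (atom V \<F> y)))"
  unfolding avg_def avg1_def by (simp add: sum_divide_distrib mult.commute)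

text \<open>Both sides equal a double sum over pairs lying in a common atom, and that relation is
  symmetric; this is the defining property of a conditional expectation, tested against a function
  constant on atoms.\<close>

lemma sum_avg1_mult:
  assumes V: "finite V" and h: "\<And>x u. x \<in> V \<Longrightarrow> u \<in> atom V \<F> x \<Longrightarrow> h u = h x"
  shows "(\<Sum>x\<in>V. avg1 V \<F> f x * h x) = (\<Sum>x\<in>V. f x * h x)"
proof -
  have "(\<Sum>x\<in>V. avg1 V \<F> f x * h x)
      = (\<Sum>x\<in>V. \<Sum>u\<in>V. if u \<in> atom V \<F> x then f u * h u / card (atom V \<F> u) else 0)"
  proof (rule sum.cong[OF refl])
    fix x assume x: "x \<in> V"
    have "avg1 V \<F> f x * h x = (\<Sum>u\<in>atom V \<F> x. f u * h x / card (atom V \<F> x))"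
      by (simp add: avg1_def sum_distrib_right sum_divide_distrib)
    also have "\<dots> = (\<Sum>u\<in>atom V \<F> x. f u * h u / card (atom V \<F> u))"
      by (rule sum.cong) (auto simp: atom_eq h[OF x])
    also have "\<dots> = (\<Sum>u\<in>V. if u \<in> atom V \<F> x then f u * h u / card (atom V \<F> u) else 0)"
      using V atom_subset[of V \<F> x] by (simp add: sum.inter_restrict[symmetric] Int_absorb1)
    finally show "avg1 V \<F> f x * h x = \<dots>" .
  qed
  also have "\<dots> = (\<Sum>u\<in>V. \<Sum>x\<in>V. if x \<in> atom V \<F> u then f u * h u / card (atom V \<F> u) else 0)"
    by (subst sum.swap, intro sum.cong refl if_cong) (auto intro: atom_sym)
  also have "\<dots> = (\<Sum>u\<in>V. f u * h u)"
  proof (rule sum.cong[OF refl])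
    fix u assume u: "u \<in> V"
    have "(\<Sum>x\<in>V. if x \<in> atom V \<F> u then f u * h u / card (atom V \<F> u) else 0)
        = (\<Sum>x\<in>atom V \<F> u. f u * h u / card (atom V \<F> u))"
      using V atom_subset[of V \<F> u] by (simp add: sum.inter_restrict[symmetric] Int_absorb1)
    also have "\<dots> = f u * h u"
      using card_atom_pos[OF V u, of \<F>] by simp
    finally show "(\<Sum>x\<in>V. if x \<in> atom V \<F> u then f u * h u / card (atom V \<F> u) else 0) = f u * h u" .
  qed
  finally show ?thesis .
qed

lemma sum_avg_mult:
  assumes V: "finite V" and h: "blockwise V \<F> h"
  shows "(\<Sum>x\<in>V. \<Sum>y\<in>V. avg V \<F> f x y * h x y) = (\<Sum>x\<in>V. \<Sum>y\<in>V. f x y * h x y)"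
proof -
  have h1: "h u y = h x y" if "y \<in> V" "x \<in> V" "u \<in> atom V \<F> x" for x y u
    using h that(1,2) that(3) atom_self[OF that(1), of \<F>] unfolding blockwise_def by blast
  have h2: "h x v = h x y" if "x \<in> V" "y \<in> V" "v \<in> atom V \<F> y" for x y v
    using h that(1,2) that(3) atom_self[OF that(1), of \<F>] unfolding blockwise_def by blast
  have "(\<Sum>x\<in>V. \<Sum>y\<in>V. avg V \<F> f x y * h x y)
      = (\<Sum>y\<in>V. \<Sum>x\<in>V. avg1 V \<F> (\<lambda>u. avg1 V \<F> (f u) y) x * h x y)"
    by (subst sum.swap) (simp add: avg_def)
  also have "\<dots> = (\<Sum>y\<in>V. \<Sum>x\<in>V. avg1 V \<F> (f x) y * h x y)"
    by (intro sum.cong refl sum_avg1_mult V h1)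
  also have "\<dots> = (\<Sum>x\<in>V. \<Sum>y\<in>V. avg1 V \<F> (f x) y * h x y)"
    by (rule sum.swap)
  also have "\<dots> = (\<Sum>x\<in>V. \<Sum>y\<in>V. f x y * h x y)"
    by (intro sum.cong refl sum_avg1_mult V h2)
  finally show ?thesis .
qed

text \<open>An atom is determined by which members of \<open>\<F>\<close> contain its points, so
  there are at most \<open>2 ^ card \<F>\<close> atoms, and each small one contributes at most
  \<open>t\<close> points.\<close>

lemma card_small_atoms:
  assumes V: "finite V" and F: "finite \<F>" and t: "0 \<le> t"
  shows "real (card {x\<in>V. real (card (atom V \<F> x)) < t}) \<le> 2 ^ card \<F> * t"
proof -
  define U where "U = {x\<in>V. real (card (atom V \<F> x)) < t}"
  define pat where "pat = (\<lambda>x. {S\<in>\<F>. x \<in> S})"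
  have "pat x \<in> Pow \<F>" for x by (auto simp: pat_def)
  then have "U = (\<Union>p\<in>Pow \<F>. {x\<in>U. pat x = p})" by blast
  then have "card U \<le> (\<Sum>p\<in>Pow \<F>. card {x\<in>U. pat x = p})"
    using card_UN_le[of "Pow \<F>" "\<lambda>p. {x\<in>U. pat x = p}"] F by simp
  then have "real (card U) \<le> (\<Sum>p\<in>Pow \<F>. real (card {x\<in>U. pat x = p}))"
    by (metis of_nat_le_iff of_nat_sum)
  also have "\<dots> \<le> (\<Sum>p\<in>Pow \<F>. t)"
  proof (rule sum_mono)
    fix p
    show "real (card {x\<in>U. pat x = p}) \<le> t"
    proof (cases "{x\<in>U. pat x = p} = {}")
      case True
      show ?thesis unfolding True using t by simp
    next
      case False
      then obtain y where y: "y \<in> U" "pat y = p" by blast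
      have "{x\<in>U. pat x = p} \<subseteq> atom V \<F> y"
        using y by (auto simp: U_def pat_def atom_def)
      then have "card {x\<in>U. pat x = p} \<le> card (atom V \<F> y)"
        using finite_atom[OF V] by (intro card_mono) auto
      then show ?thesis using y(1) by (simp add: U_def)
    qed
  qed
  also have "\<dots> = 2 ^ card \<F> * t" using F by (simp add: card_Pow)
  finally show ?thesis unfolding U_def .
qed

section \<open>Sparse regularity by truncated energy increment\<close>

definition trunc :: "'a set \<Rightarrow> 'a set set \<Rightarrow> ('a \<Rightarrow> 'a \<Rightarrow> real) \<Rightarrow> real \<Rightarrow> 'a \<Rightarrow> 'a \<Rightarrow> real" where
  "trunc V \<F> f b x y = min (avg V \<F> f x y) b"

text \<open>Up to the constant sum of \<open>(f x y)\<^sup>2\<close>, this is minus the squared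
  distance from \<open>f\<close> to \<open>h\<close>. Maximising it over a convex set therefore
  means projecting \<open>f\<close> onto that set.\<close>

definition quad :: "'a set \<Rightarrow> ('a \<Rightarrow> 'a \<Rightarrow> real) \<Rightarrow> ('a \<Rightarrow> 'a \<Rightarrow> real) \<Rightarrow> real" where
  "quad V f h = (\<Sum>x\<in>V. \<Sum>y\<in>V. 2 * f x y * h x y - (h x y)\<^sup>2)"

definition energy :: "'a set \<Rightarrow> ('a \<Rightarrow> 'a \<Rightarrow> real) \<Rightarrow> real \<Rightarrow> 'a set set \<Rightarrow> real" where
  "energy V f b \<F> = quad V f (trunc V \<F> f b)"

lemma blockwise_trunc: "blockwise V \<F> (trunc V \<F> f b)"
  using blockwise_avg[of V \<F> f] unfolding blockwise_def trunc_def by simp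

lemma trunc_le: "trunc V \<F> f b x y \<le> b"
  by (simp add: trunc_def)

lemma avg_nonneg: "(\<And>x y. 0 \<le> f x y) \<Longrightarrow> 0 \<le> avg V \<F> f x y"
  unfolding avg_def by (intro avg1_nonneg)

lemma trunc_nonneg: "(\<And>x y. 0 \<le> f x y) \<Longrightarrow> 0 \<le> b \<Longrightarrow> 0 \<le> trunc V \<F> f b x y"
  by (simp add: trunc_def avg_nonneg)

text \<open>The truncated average is the projection of \<^term>\<open>f\<close> onto the convex set of blockwise
  functions bounded above by \<^term>\<open>b\<close>.\<close>

lemma quad_le_energy:
  assumes V: "finite V" and h: "blockwise V \<F> h" and hb: "\<And>x y. h x y \<le> b"
  shows "quad V f h + (\<Sum>x\<in>V. \<Sum>y\<in>V. (h x y - trunc V \<F> f b x y)\<^sup>2) \<le> energy V f b \<F>"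
proof -
  let ?g = "trunc V \<F> f b" and ?a = "avg V \<F> f"
  have bw: "blockwise V \<F> (\<lambda>x y. h x y - ?g x y)"
    using h blockwise_trunc[of V \<F> f b] unfolding blockwise_def by simp
  have "(\<Sum>x\<in>V. \<Sum>y\<in>V. (f x y - ?g x y) * (h x y - ?g x y))
      = (\<Sum>x\<in>V. \<Sum>y\<in>V. (?a x y - ?g x y) * (h x y - ?g x y))"
    using sum_avg_mult[OF V bw, of f] by (simp add: left_diff_distrib sum_subtractf)
  \<comment> \<open>The average differs from its truncation only where it exceeds \<open>b\<close>;
    there the truncation equals \<open>b\<close>, which is an upper bound of \<open>h\<close>, so
    the two factors have opposite signs.\<close>
  also have "\<dots> \<le> 0"
  proof (intro sum_nonpos)
    fix x y
    show "(?a x y - ?g x y) * (h x y - ?g x y) \<le> 0"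
      using hb[of x y] by (auto simp: trunc_def min_def mult_le_0_iff)
  qed
  finally have "2 * (\<Sum>x\<in>V. \<Sum>y\<in>V. (f x y - ?g x y) * (h x y - ?g x y)) \<le> 0" by simp
  moreover have "quad V f h + (\<Sum>x\<in>V. \<Sum>y\<in>V. (h x y - ?g x y)\<^sup>2)
      = quad V f ?g + 2 * (\<Sum>x\<in>V. \<Sum>y\<in>V. (f x y - ?g x y) * (h x y - ?g x y))"
    unfolding quad_def sum_distrib_left sum.distrib[symmetric]
    by (intro sum.cong refl) (simp add: power2_eq_square algebra_simps)
  ultimately show ?thesis by (simp add: energy_def)
qed

text \<open>The truncated average over the coarser system is an admissible competitor for the
  projection over the finer one, so the squared distance of the two is gained.\<close>

lemma energy_mono:
  assumes V: "finite V" and "\<F> \<subseteq> \<G>"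
  shows "energy V f b \<F> + (\<Sum>x\<in>V. \<Sum>y\<in>V. (trunc V \<F> f b x y - trunc V \<G> f b x y)\<^sup>2)
    \<le> energy V f b \<G>"
  using quad_le_energy[OF V blockwise_mono[OF blockwise_trunc assms(2)] trunc_le, of f f b]
  by (simp add: energy_def)

lemma energy_nonneg: "finite V \<Longrightarrow> 0 \<le> b \<Longrightarrow> 0 \<le> energy V f b \<F>"
proof -
  assume V: "finite V" and b: "0 \<le> b"
  have "quad V f (\<lambda>x y. 0) + (\<Sum>x\<in>V. \<Sum>y\<in>V. (0 - trunc V \<F> f b x y)\<^sup>2) \<le> energy V f b \<F>"
    by (rule quad_le_energy[OF V]) (auto simp: blockwise_def b)
  moreover have "0 \<le> (\<Sum>x\<in>V. \<Sum>y\<in>V. (0 - trunc V \<F> f b x y)\<^sup>2)"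
    by (intro sum_nonneg) simp
  ultimately show ?thesis by (simp add: quad_def)
qed

lemma energy_upper:
  assumes "\<And>x y. 0 \<le> f x y"
  shows "energy V f b \<F> \<le> 2 * b * (\<Sum>x\<in>V. \<Sum>y\<in>V. f x y)"
  unfolding energy_def quad_def sum_distrib_left
proof (intro sum_mono)
  fix x y
  have "2 * f x y * trunc V \<F> f b x y - (trunc V \<F> f b x y)\<^sup>2 \<le> 2 * f x y * trunc V \<F> f b x y"
    by simp
  also have "\<dots> \<le> 2 * f x y * b"
    by (intro mult_left_mono trunc_le) (simp add: assms)
  finally show "2 * f x y * trunc V \<F> f b x y - (trunc V \<F> f b x y)\<^sup>2 \<le> 2 * b * f x y"
    by (simp add: mult.commute mult.left_commute)
qed

text \<open>Half of closeness in cut norm: a rectangle may carry any surplus of \<open>f\<close>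
  over \<open>g\<close>, only its deficit is limited.\<close>

definition cut_lower :: "'a set \<Rightarrow> ('a \<Rightarrow> 'a \<Rightarrow> real) \<Rightarrow> ('a \<Rightarrow> 'a \<Rightarrow> real) \<Rightarrow> real \<Rightarrow> bool" where
  "cut_lower V f g \<kappa> \<longleftrightarrow> (\<forall>S\<subseteq>V. \<forall>T\<subseteq>V. - \<kappa> \<le> (\<Sum>x\<in>S. \<Sum>y\<in>T. f x y - g x y))"

text \<open>Lowering the truncated average by a small constant \<open>t\<close> on the deficient
  rectangle gives a better competitor. Lowering never violates the upper bound \<open>b\<close>,
  which is why deficits can always be corrected.\<close>

lemma energy_increment:
  assumes V: "finite V" "V \<noteq> {}" and \<kappa>: "0 < \<kappa>" and S: "S \<subseteq> V" and T: "T \<subseteq> V"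
    and viol: "(\<Sum>x\<in>S. \<Sum>y\<in>T. f x y - trunc V \<F> f b x y) < - \<kappa>"
  shows "energy V f b \<F> + \<kappa>\<^sup>2 / (real (card V))\<^sup>2 \<le> energy V f b (\<F> \<union> {S, T})"
proof -
  let ?g = "trunc V \<F> f b"
  define n where "n = real (card V)"
  \<comment> \<open>This value maximises the guaranteed gain
    \<open>2 * t * \<kappa> - t\<^sup>2 * n\<^sup>2\<close>.\<close>
  define t where "t = \<kappa> / n\<^sup>2"
  define i where "i = (\<lambda>x y. if x \<in> S \<and> y \<in> T then 1 else (0::real))"
  define h where "h = (\<lambda>x y. ?g x y - t * i x y)"
  have n: "n > 0" using V by (simp add: n_def card_gt_0_iff)
  have t: "t > 0" using n \<kappa> by (simp add: t_def)
  have isum: "(\<Sum>x\<in>V. \<Sum>y\<in>V. w x y * i x y) = (\<Sum>x\<in>S. \<Sum>y\<in>T. w x y)" for w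
  proof -
    have "(\<Sum>x\<in>V. \<Sum>y\<in>V. w x y * i x y) = (\<Sum>x\<in>V. if x \<in> S then (\<Sum>y\<in>T. w x y) else 0)"
      using V T unfolding i_def
      by (intro sum.cong refl)
         (auto simp: sum.inter_restrict[symmetric] Int_absorb1 if_distrib[of "\<lambda>c. _ * c"] cong: if_cong)
    also have "\<dots> = (\<Sum>x\<in>S. \<Sum>y\<in>T. w x y)"
      using V S by (simp add: sum.inter_restrict[symmetric] Int_absorb1)
    finally show ?thesis .
  qed
  have bw: "blockwise V (\<F> \<union> {S, T}) h"
  proof -
    have "blockwise V (\<F> \<union> {S, T}) ?g" by (rule blockwise_mono[OF blockwise_trunc]) auto
    moreover have "blockwise V (\<F> \<union> {S, T}) i"
      unfolding blockwise_def i_def atom_def by auto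
    ultimately show ?thesis unfolding blockwise_def h_def by simp
  qed
  have hb: "h x y \<le> b" for x y
    using trunc_le[of V \<F> f b x y] t by (simp add: h_def i_def)
  have "quad V f h = quad V f ?g - 2 * t * (\<Sum>x\<in>V. \<Sum>y\<in>V. (f x y - ?g x y) * i x y)
          - t\<^sup>2 * (\<Sum>x\<in>V. \<Sum>y\<in>V. 1 * i x y)"
    unfolding quad_def h_def sum_distrib_left sum_subtractf[symmetric]
    by (intro sum.cong refl) (auto simp: i_def power2_eq_square algebra_simps)
  also have "\<dots> = energy V f b \<F> - 2 * t * (\<Sum>x\<in>S. \<Sum>y\<in>T. f x y - ?g x y)
      - t\<^sup>2 * (card S * card T)"
    unfolding isum by (simp add: energy_def)
  also have "\<dots> \<ge> energy V f b \<F> + 2 * t * \<kappa> - t\<^sup>2 * n\<^sup>2"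
  proof -
    have "t * (\<Sum>x\<in>S. \<Sum>y\<in>T. f x y - ?g x y) \<le> t * (- \<kappa>)"
      using viol t by (intro mult_left_mono) auto
    moreover have "real (card S) * real (card T) \<le> n * n"
      unfolding n_def using V S T by (intro mult_mono) (auto intro: card_mono)
    then have "t\<^sup>2 * (real (card S) * real (card T)) \<le> t\<^sup>2 * n\<^sup>2"
      by (intro mult_left_mono) (auto simp: power2_eq_square)
    ultimately show ?thesis by simp
  qed
  finally have "energy V f b \<F> + 2 * t * \<kappa> - t\<^sup>2 * n\<^sup>2 \<le> quad V f h" .
  moreover have "2 * t * \<kappa> - t\<^sup>2 * n\<^sup>2 = \<kappa>\<^sup>2 / n\<^sup>2"
    using n by (simp add: t_def field_simps power2_eq_square)
  moreover have "quad V f h \<le> energy V f b (\<F> \<union> {S, T})"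
  proof -
    have "0 \<le> (\<Sum>x\<in>V. \<Sum>y\<in>V. (h x y - trunc V (\<F> \<union> {S, T}) f b x y)\<^sup>2)"
      by (intro sum_nonneg) simp
    then show ?thesis using quad_le_energy[OF V(1) bw hb, of f] by linarith
  qed
  ultimately show ?thesis by (simp add: n_def)
qed

section \<open>Iterating the increment: weak and strong regularity\<close>

text \<open>Here \<open>k\<close> is the number of increments that still fit below the ceiling
  \<open>B\<close>. Each violation uses up one of them and adds two sets; at \<open>k = 0\<close> a
  violation would push the energy above \<open>B\<close>.\<close>

lemma weak_regularity:
  assumes V: "finite V" "V \<noteq> {}" and \<kappa>: "0 < \<kappa>"
    and ub: "\<And>\<F>. energy V f b \<F> \<le> B"
    and "finite \<P>" and "B \<le> energy V f b \<P> + real k * (\<kappa>\<^sup>2 / (real (card V))\<^sup>2)"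
  shows "\<exists>\<Q>. \<P> \<subseteq> \<Q> \<and> finite \<Q> \<and> card \<Q> \<le> card \<P> + 2 * k \<and> cut_lower V f (trunc V \<Q> f b) \<kappa>"
  using assms(5,6)
proof (induction k arbitrary: \<P>)
  case 0
  have pos: "0 < \<kappa>\<^sup>2 / (real (card V))\<^sup>2" using V \<kappa> by (simp add: card_gt_0_iff)
  have "cut_lower V f (trunc V \<P> f b) \<kappa>"
    unfolding cut_lower_def
  proof (intro allI impI, rule ccontr)
    fix S T assume ST: "S \<subseteq> V" "T \<subseteq> V"
      and "\<not> - \<kappa> \<le> (\<Sum>x\<in>S. \<Sum>y\<in>T. f x y - trunc V \<P> f b x y)"
    then have "energy V f b \<P> + \<kappa>\<^sup>2 / (real (card V))\<^sup>2 \<le> energy V f b (\<P> \<union> {S, T})"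
      by (intro energy_increment[OF V \<kappa> ST]) simp
    then show False using ub[of "\<P> \<union> {S, T}"] 0 pos by simp
  qed
  then show ?case using 0 by auto
next
  case (Suc k)
  show ?case
  proof (cases "cut_lower V f (trunc V \<P> f b) \<kappa>")
    case True
    then show ?thesis using Suc.prems by auto
  next
    case False
    then obtain S T where ST: "S \<subseteq> V" "T \<subseteq> V"
      "(\<Sum>x\<in>S. \<Sum>y\<in>T. f x y - trunc V \<P> f b x y) < - \<kappa>"
      unfolding cut_lower_def by (auto simp: not_le)
    let ?P = "\<P> \<union> {S, T}"
    have "B \<le> energy V f b ?P + real k * (\<kappa>\<^sup>2 / (real (card V))\<^sup>2)"
      using energy_increment[OF V \<kappa> ST] Suc.prems(2) unfolding of_nat_Suc distrib_right by linarith
    then obtain \<Q> where Q: "?P \<subseteq> \<Q>" "finite \<Q>" "card \<Q> \<le> card ?P + 2 * k"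
      "cut_lower V f (trunc V \<Q> f b) \<kappa>"
      using Suc.IH[of ?P] Suc.prems by auto
    moreover have "card ?P \<le> card \<P> + 2"
      using card_Un_le[of \<P> "{S,T}"] card_insert_le_m1[of 2 "{T}" S] by simp
    ultimately show ?thesis by (intro exI[of _ \<Q>]) auto
  qed
qed

definition regular_pair ::
  "'a set \<Rightarrow> ('a \<Rightarrow> 'a \<Rightarrow> real) \<Rightarrow> real \<Rightarrow> real \<Rightarrow> real \<Rightarrow> 'a set set \<Rightarrow> 'a set set \<Rightarrow> bool" where
  "regular_pair V f b \<kappa> \<alpha> \<P> \<Q> \<longleftrightarrow> cut_lower V f (trunc V \<Q> f b) \<kappa> \<and>
     (\<Sum>x\<in>V. \<Sum>y\<in>V. (trunc V \<P> f b x y - trunc V \<Q> f b x y)\<^sup>2) \<le> \<alpha>"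

text \<open>With energy of order \<open>n\<close> and cut error of order \<open>n * sqrt n\<close>,
  every increment gains at least \<open>\<eta>\<^sup>2 * n\<close>. The number of added sets then
  depends on \<open>K\<close> and \<open>\<eta>\<close> only, not on \<open>n\<close>.\<close>

lemma strong_regularity_step:
  fixes f :: "'a \<Rightarrow> 'a \<Rightarrow> real" and K \<eta> :: real
  defines "k \<equiv> nat \<lceil>K / \<eta>\<^sup>2\<rceil>"
  assumes V: "finite V" "V \<noteq> {}" and \<eta>: "0 < \<eta>" and b: "0 \<le> b"
    and ub: "\<And>\<F>. energy V f b \<F> \<le> K * card V" and P: "finite \<P>"
  shows "\<exists>\<Q>. \<P> \<subseteq> \<Q> \<and> finite \<Q> \<and> card \<Q> \<le> card \<P> + 2 * k \<and>
    cut_lower V f (trunc V \<Q> f b) (\<eta> * card V * sqrt (card V))"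
proof (rule weak_regularity[OF V _ ub P])
  have n: "0 < real (card V)" using V by (simp add: card_gt_0_iff)
  then show "0 < \<eta> * card V * sqrt (card V)" using \<eta> by simp
  have eq: "(\<eta> * card V * sqrt (card V))\<^sup>2 / (real (card V))\<^sup>2 = \<eta>\<^sup>2 * card V"
    using n by (simp add: power_mult_distrib)
  have "K / \<eta>\<^sup>2 \<le> real k" unfolding k_def by (rule real_nat_ceiling_ge)
  then have "K \<le> real k * \<eta>\<^sup>2" using \<eta> by (simp add: field_simps)
  then have "K * card V \<le> real k * \<eta>\<^sup>2 * card V" using n by (intro mult_right_mono) auto
  then show "K * card V \<le> energy V f b \<P>
      + real k * ((\<eta> * card V * sqrt (card V))\<^sup>2 / (real (card V))\<^sup>2)"
    using energy_nonneg[OF V(1) b, of f \<P>] unfolding eq by (simp add: mult.assoc)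
qed

text \<open>Here \<open>j\<close> counts the energy gains of size \<open>\<alpha> * card V\<close>
  still possible. The cut error may shrink with the complexity: \<open>\<eta>\<close> is evaluated
  at a bound \<open>m'\<close> for the size of the coarse system, and \<open>N\<close> bounds all
  values \<open>m'\<close> uniformly in the graph.\<close>

lemma strong_regularity_aux:
  fixes \<eta> :: "nat \<Rightarrow> real" and \<alpha> K :: real
  assumes \<alpha>: "0 < \<alpha>" and \<eta>: "\<And>m. 0 < \<eta> m"
  shows "\<exists>N. \<forall>(V::'a set) f b \<P>. finite V \<longrightarrow> V \<noteq> {} \<longrightarrow> 0 \<le> b \<longrightarrow>
      (\<forall>\<F>. energy V f b \<F> \<le> K * card V) \<longrightarrow> finite \<P> \<longrightarrow> card \<P> \<le> m \<longrightarrow>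
      (K - real j * \<alpha>) * card V \<le> energy V f b \<P> \<longrightarrow>
      (\<exists>\<P>' \<Q> m'. finite \<P>' \<and> card \<P>' \<le> m' \<and> m' \<le> N \<and>
        regular_pair V f b (\<eta> m' * card V * sqrt (card V)) (\<alpha> * card V) \<P>' \<Q>)"
proof (induction j arbitrary: m)
  case (0 m)
  show ?case
  proof (intro exI[of _ m] allI impI)
    fix V :: "'a set" and f b \<P>
    assume V: "finite V" "V \<noteq> {}" and b: "(0::real) \<le> b"
      and ub: "\<forall>\<F>. energy V f b \<F> \<le> K * card V" and P: "finite \<P>" "card \<P> \<le> m"
      and en: "(K - real 0 * \<alpha>) * card V \<le> energy V f b \<P>"
    obtain \<Q> where Q: "\<P> \<subseteq> \<Q>" "finite \<Q>"
      "cut_lower V f (trunc V \<Q> f b) (\<eta> m * card V * sqrt (card V))"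
      using strong_regularity_step[OF V \<eta> b _ P(1), of f K m] ub by blast
    \<comment> \<open>With \<open>j = 0\<close> the energy of \<open>\<P>\<close> is already
      maximal, so passing to \<open>\<Q>\<close> cannot move the truncated average at all.\<close>
    have "energy V f b \<Q> \<le> K * card V" using ub by blast
    moreover have "0 \<le> \<alpha> * card V" using \<alpha> by simp
    ultimately have "regular_pair V f b (\<eta> m * card V * sqrt (card V)) (\<alpha> * card V) \<P> \<Q>"
      using Q(3) energy_mono[OF V(1) Q(1), of f b] en by (simp add: regular_pair_def)
    then show "\<exists>\<P>' \<Q> m'. finite \<P>' \<and> card \<P>' \<le> m' \<and> m' \<le> m \<and>
        regular_pair V f b (\<eta> m' * card V * sqrt (card V)) (\<alpha> * card V) \<P>' \<Q>"
      using P by blast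
  qed
next
  case (Suc j m)
  \<comment> \<open>Bounds the size of the refinement produced by one step; the induction hypothesis
    is applied to that refinement.\<close>
  let ?m = "m + 2 * nat \<lceil>K / (\<eta> m)\<^sup>2\<rceil>"
  obtain N where N: "\<And>(V::'a set) f b \<P>. finite V \<Longrightarrow> V \<noteq> {} \<Longrightarrow> 0 \<le> b \<Longrightarrow>
      (\<forall>\<F>. energy V f b \<F> \<le> K * card V) \<Longrightarrow> finite \<P> \<Longrightarrow> card \<P> \<le> ?m \<Longrightarrow>
      (K - real j * \<alpha>) * card V \<le> energy V f b \<P> \<Longrightarrow>
      (\<exists>\<P>' \<Q> m'. finite \<P>' \<and> card \<P>' \<le> m' \<and> m' \<le> N \<and>
        regular_pair V f b (\<eta> m' * card V * sqrt (card V)) (\<alpha> * card V) \<P>' \<Q>)"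
    using Suc[of ?m] by blast
  show ?case
  proof (intro exI[of _ "max m N"] allI impI)
    fix V :: "'a set" and f b \<P>
    assume V: "finite V" "V \<noteq> {}" and b: "(0::real) \<le> b"
      and ub: "\<forall>\<F>. energy V f b \<F> \<le> K * card V" and P: "finite \<P>" "card \<P> \<le> m"
      and en: "(K - real (Suc j) * \<alpha>) * card V \<le> energy V f b \<P>"
    obtain \<Q> where Q: "\<P> \<subseteq> \<Q>" "finite \<Q>" "card \<Q> \<le> card \<P> + 2 * nat \<lceil>K / (\<eta> m)\<^sup>2\<rceil>"
      "cut_lower V f (trunc V \<Q> f b) (\<eta> m * card V * sqrt (card V))"
      using strong_regularity_step[OF V \<eta> b _ P(1), of f K m] ub by blast
    show "\<exists>\<P>' \<Q> m'. finite \<P>' \<and> card \<P>' \<le> m' \<and> m' \<le> max m N \<and>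
        regular_pair V f b (\<eta> m' * card V * sqrt (card V)) (\<alpha> * card V) \<P>' \<Q>"
    proof (cases "regular_pair V f b (\<eta> m * card V * sqrt (card V)) (\<alpha> * card V) \<P> \<Q>")
      case True
      then show ?thesis using P by (meson max.cobounded1)
    next
      case False
      \<comment> \<open>The cut condition holds for \<open>\<Q>\<close>, so regularity can fail only
        through the squared distance, which \<open>energy_mono\<close> turns into an energy
        gain.\<close>
      then have "energy V f b \<P> + \<alpha> * card V \<le> energy V f b \<Q>"
        using Q(4) energy_mono[OF V(1) Q(1), of f b] by (simp add: regular_pair_def)
      then have "(K - real j * \<alpha>) * card V \<le> energy V f b \<Q>"
        using en by (simp add: algebra_simps)
      then obtain \<P>' \<Q>' m' where "finite \<P>'" "card \<P>' \<le> m'" "m' \<le> N"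
        "regular_pair V f b (\<eta> m' * card V * sqrt (card V)) (\<alpha> * card V) \<P>' \<Q>'"
        using N[OF V b ub Q(2)] Q(3) P(2) by auto
      then show ?thesis by (meson max.coboundedI2)
    qed
  qed
qed

text \<open>Truncation at \<^term>\<open>c / sqrt (card V)\<close> bounds the energy by the number of edges alone, whatever
  the sizes of the atoms.\<close>

lemma strong_regularity:
  fixes \<eta> :: "nat \<Rightarrow> real" and \<alpha> c M :: real
  assumes \<alpha>: "0 < \<alpha>" and \<eta>: "\<And>m. 0 < \<eta> m" and c: "0 \<le> c"
  shows "\<exists>N. \<forall>(V::'a set) f. finite V \<longrightarrow> V \<noteq> {} \<longrightarrow> (\<forall>x y. 0 \<le> f x y) \<longrightarrow>
      (\<Sum>x\<in>V. \<Sum>y\<in>V. f x y) \<le> M * card V * sqrt (card V) \<longrightarrow>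
      (\<exists>\<P> \<Q> m. finite \<P> \<and> card \<P> \<le> m \<and> m \<le> N \<and>
        regular_pair V f (c / sqrt (card V)) (\<eta> m * card V * sqrt (card V)) (\<alpha> * card V) \<P> \<Q>)"
proof -
  define K where "K = 2 * c * M"
  \<comment> \<open>Enough rounds to make \<open>K - j * \<alpha>\<close> nonpositive, so that the
    iteration can start from the empty system, that is, from the one-block partition.\<close>
  define j where "j = nat \<lceil>K / \<alpha>\<rceil>"
  obtain N where N: "\<forall>(V::'a set) f b \<P>. finite V \<longrightarrow> V \<noteq> {} \<longrightarrow> 0 \<le> b \<longrightarrow>
      (\<forall>\<F>. energy V f b \<F> \<le> K * card V) \<longrightarrow> finite \<P> \<longrightarrow> card \<P> \<le> 0 \<longrightarrow>
      (K - real j * \<alpha>) * card V \<le> energy V f b \<P> \<longrightarrow>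
      (\<exists>\<P>' \<Q> m'. finite \<P>' \<and> card \<P>' \<le> m' \<and> m' \<le> N \<and>
        regular_pair V f b (\<eta> m' * card V * sqrt (card V)) (\<alpha> * card V) \<P>' \<Q>)"
    using strong_regularity_aux[OF \<alpha> \<eta>, where 'a = 'a and K = K and m = 0 and j = j] ..
  have "K / \<alpha> \<le> real j" unfolding j_def by (rule real_nat_ceiling_ge)
  then have j: "K - real j * \<alpha> \<le> 0" using \<alpha> by (simp add: field_simps)
  show ?thesis
  proof (intro exI[of _ N] allI impI)
    fix V :: "'a set" and f :: "'a \<Rightarrow> 'a \<Rightarrow> real"
    assume V: "finite V" "V \<noteq> {}" and f: "\<forall>x y. 0 \<le> f x y"
      and s: "(\<Sum>x\<in>V. \<Sum>y\<in>V. f x y) \<le> M * card V * sqrt (card V)"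
    define b where "b = c / sqrt (card V)"
    have b: "0 \<le> b" using c by (simp add: b_def)
    have n: "0 < real (card V)" using V by (simp add: card_gt_0_iff)
    have "energy V f b \<F> \<le> K * card V" for \<F>
    proof -
      have "energy V f b \<F> \<le> 2 * b * (\<Sum>x\<in>V. \<Sum>y\<in>V. f x y)" using f by (intro energy_upper) auto
      also have "\<dots> \<le> 2 * b * (M * card V * sqrt (card V))" using b s by (intro mult_left_mono) auto
      also have "\<dots> = K * card V" using n by (simp add: b_def K_def)
      finally show ?thesis .
    qed
    moreover have "(K - real j * \<alpha>) * card V \<le> energy V f b {}"
      using mult_nonpos_nonneg[OF j, of "card V"] energy_nonneg[OF V(1) b, of f "{}"] by simp
    ultimately show "\<exists>\<P> \<Q> m. finite \<P> \<and> card \<P> \<le> m \<and> m \<le> N \<and>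
        regular_pair V f (c / sqrt (card V)) (\<eta> m * card V * sqrt (card V)) (\<alpha> * card V) \<P> \<Q>"
      using N[rule_format, OF V b, of f "{}"] unfolding b_def by simp
  qed
qed

section \<open>Counting 5-cycles\<close>

text \<open>A linear form in weights from \<open>[0, a]\<close> is smallest when the weight is
  \<open>a\<close> on the negative coefficients and \<open>0\<close> elsewhere.\<close>

lemma sum_weight_ge_sum_neg:
  fixes r u :: "'a \<Rightarrow> real"
  assumes "finite A" and "\<And>x. x \<in> A \<Longrightarrow> 0 \<le> u x" and "\<And>x. x \<in> A \<Longrightarrow> u x \<le> a"
  shows "a * (\<Sum>x\<in>{x\<in>A. r x < 0}. r x) \<le> (\<Sum>x\<in>A. r x * u x)"
proof -
  have "a * (\<Sum>x\<in>{x\<in>A. r x < 0}. r x) = (\<Sum>x\<in>A. if r x < 0 then a * r x else 0)"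
    using assms(1) by (simp add: sum_distrib_left sum.inter_filter if_distrib[of "(*) a"] cong: if_cong)
  also have "\<dots> \<le> (\<Sum>x\<in>A. r x * u x)"
  proof (rule sum_mono)
    fix x assume x: "x \<in> A"
    show "(if r x < 0 then a * r x else 0) \<le> r x * u x"
      using assms(2,3)[OF x] mult_left_mono_neg[of "u x" a "r x"] by (auto simp: mult.commute)
  qed
  finally show ?thesis .
qed

text \<open>The form is linear in each weight separately. Rounding first \<open>u\<close> and then
  \<open>v\<close> to the extreme weights reduces it to the single rectangle \<open>S\<close> times
  \<open>T\<close>.\<close>

lemma cut_lower_weighted:
  assumes V: "finite V" and cut: "cut_lower V f g \<kappa>" and A: "A \<subseteq> V" and B: "B \<subseteq> V"
    and u: "\<And>x. x \<in> A \<Longrightarrow> 0 \<le> u x" "\<And>x. x \<in> A \<Longrightarrow> u x \<le> a" and a: "0 \<le> a"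
    and v: "\<And>y. y \<in> B \<Longrightarrow> 0 \<le> v y" "\<And>y. y \<in> B \<Longrightarrow> v y \<le> c" and c: "0 \<le> c"
  shows "- (\<kappa> * a * c) \<le> (\<Sum>x\<in>A. \<Sum>y\<in>B. (f x y - g x y) * u x * v y)"
proof -
  have fin: "finite A" "finite B" using V A B finite_subset by auto
  let ?D = "\<lambda>x y. f x y - g x y"
  let ?r = "\<lambda>x. \<Sum>y\<in>B. ?D x y * v y"
  define S where "S = {x\<in>A. ?r x < 0}"
  let ?q = "\<lambda>y. \<Sum>x\<in>S. ?D x y"
  define T where "T = {y\<in>B. ?q y < 0}"
  have "S \<subseteq> V" "T \<subseteq> V" using A B by (auto simp: S_def T_def)
  then have "- \<kappa> \<le> (\<Sum>x\<in>S. \<Sum>y\<in>T. ?D x y)"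
    using cut by (simp add: cut_lower_def)
  also have "\<dots> = (\<Sum>y\<in>T. ?q y)" by (rule sum.swap)
  finally have "- \<kappa> \<le> (\<Sum>y\<in>T. ?q y)" .
  then have "c * (- \<kappa>) \<le> c * (\<Sum>y\<in>T. ?q y)" using c by (intro mult_left_mono)
  also have "\<dots> \<le> (\<Sum>y\<in>B. ?q y * v y)"
    unfolding T_def by (rule sum_weight_ge_sum_neg[OF fin(2)]) (auto intro: v)
  also have "\<dots> = (\<Sum>x\<in>S. ?r x)"
    unfolding sum_distrib_right by (rule sum.swap)
  finally have "a * (c * (- \<kappa>)) \<le> a * (\<Sum>x\<in>S. ?r x)" using a by (intro mult_left_mono)
  also have "\<dots> \<le> (\<Sum>x\<in>A. ?r x * u x)"
    unfolding S_def by (rule sum_weight_ge_sum_neg[OF fin(1)]) (auto intro: u)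
  also have "\<dots> = (\<Sum>x\<in>A. \<Sum>y\<in>B. ?D x y * u x * v y)"
    unfolding sum_distrib_right by (simp add: mult.assoc mult.commute[of "u _"])
  finally show ?thesis by (simp add: mult.commute mult.left_commute)
qed

text \<open>The trading step: one factor \<open>f x y\<close> becomes
  \<open>\<theta> * h x y\<close>, provided the remaining factors split into a bounded weight of
  \<open>x\<close> and a bounded weight of \<open>y\<close>.\<close>

lemma cut_lower_replace:
  assumes V: "finite V" and cut: "cut_lower V f g \<kappa>" and gh: "\<And>x y. \<theta> * h x y \<le> g x y"
    and A: "A \<subseteq> V" and B: "B \<subseteq> V"
    and u: "\<And>x. x \<in> A \<Longrightarrow> 0 \<le> u x" "\<And>x. x \<in> A \<Longrightarrow> u x \<le> a" and a: "0 \<le> a"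
    and v: "\<And>y. y \<in> B \<Longrightarrow> 0 \<le> v y" "\<And>y. y \<in> B \<Longrightarrow> v y \<le> c" and c: "0 \<le> c"
  shows "\<theta> * (\<Sum>x\<in>A. \<Sum>y\<in>B. h x y * u x * v y) - \<kappa> * a * c \<le> (\<Sum>x\<in>A. \<Sum>y\<in>B. f x y * u x * v y)"
proof -
  have "\<theta> * (\<Sum>x\<in>A. \<Sum>y\<in>B. h x y * u x * v y) \<le> (\<Sum>x\<in>A. \<Sum>y\<in>B. g x y * u x * v y)"
    unfolding sum_distrib_left
  proof (intro sum_mono)
    fix x y assume "x \<in> A" "y \<in> B"
    then have "(\<theta> * h x y) * (u x * v y) \<le> g x y * (u x * v y)"
      using u v gh by (intro mult_right_mono) auto
    then show "\<theta> * (h x y * u x * v y) \<le> g x y * u x * v y" by (simp add: mult.assoc)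
  qed
  moreover have "(\<Sum>x\<in>A. \<Sum>y\<in>B. (f x y - g x y) * u x * v y)
      = (\<Sum>x\<in>A. \<Sum>y\<in>B. f x y * u x * v y) - (\<Sum>x\<in>A. \<Sum>y\<in>B. g x y * u x * v y)"
    by (simp add: left_diff_distrib sum_subtractf)
  moreover have "- (\<kappa> * a * c) \<le> (\<Sum>x\<in>A. \<Sum>y\<in>B. (f x y - g x y) * u x * v y)"
    by (rule cut_lower_weighted[OF V cut A B]) (auto intro: u v a c)
  ultimately show ?thesis by linarith
qed

lemma sum_le_card_mult:
  fixes f :: "'a \<Rightarrow> real" and c :: real
  assumes "finite V" "A \<subseteq> V" "\<And>x. x \<in> A \<Longrightarrow> f x \<le> c" "0 \<le> c"
  shows "sum f A \<le> card V * c"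
proof -
  have "sum f A \<le> card A * c" using sum_bounded_above[of A f c] assms by auto
  also have "\<dots> \<le> card V * c"
    using assms card_mono by (intro mult_right_mono) auto
  finally show ?thesis .
qed

lemma sum_ge_sub_card_mult:
  fixes f g :: "'a \<Rightarrow> real" and c :: real
  assumes "finite V" "A \<subseteq> V" "\<And>x. x \<in> A \<Longrightarrow> f x - c \<le> g x" "0 \<le> c"
  shows "sum f A - card V * c \<le> sum g A"
proof -
  have "(\<Sum>x\<in>A. f x - g x) \<le> card V * c"
    by (rule sum_le_card_mult[OF assms(1,2)]) (use assms(3,4) in \<open>auto simp: algebra_simps\<close>)
  then show ?thesis by (simp add: sum_subtractf)
qed

lemma sum_swap_depth1:
  "(\<Sum>a\<in>A. \<Sum>b\<in>B. \<Sum>c\<in>C. F a b c) = (\<Sum>a\<in>A. \<Sum>c\<in>C. \<Sum>b\<in>B. F a b c)"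
  by (rule sum.cong[OF refl]) (rule sum.swap)

lemma sum_swap_depth2:
  "(\<Sum>a\<in>A. \<Sum>b\<in>B. \<Sum>c\<in>C. \<Sum>d\<in>D. F a b c d) = (\<Sum>a\<in>A. \<Sum>b\<in>B. \<Sum>d\<in>D. \<Sum>c\<in>C. F a b c d)"
  by (rule sum.cong[OF refl]) (rule sum_swap_depth1)

lemma sum_swap_depth3:
  "(\<Sum>a\<in>A. \<Sum>b\<in>B. \<Sum>c\<in>C. \<Sum>d\<in>D. \<Sum>e\<in>E. F a b c d e)
    = (\<Sum>a\<in>A. \<Sum>b\<in>B. \<Sum>c\<in>C. \<Sum>e\<in>E. \<Sum>d\<in>D. F a b c d e)"
  by (rule sum.cong[OF refl]) (rule sum_swap_depth2)

text \<open>\<open>P\<close> and \<open>P'\<close> count the 2-paths that close an edge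
  \<open>x0 x1\<close> to a 5-cycle. Trading that edge requires bounded weights, so the counts are
  first capped at \<open>1\<close>. The caps are lifted afterwards, once the edges traded so far
  have become bounded factors \<open>h\<close>, at the total cost \<open>D\<close> of the
  excess.\<close>

lemma C5_counting:
  fixes f g h :: "'a \<Rightarrow> 'a \<Rightarrow> real" and \<kappa> \<theta> d D n :: real and A0 A1 A2 A3 A4 V :: "'a set"
  defines "P \<equiv> (\<lambda>x1 x3. \<Sum>x2\<in>A2. f x1 x2 * f x2 x3)"
    and "P' \<equiv> (\<lambda>x3 x0. \<Sum>x4\<in>A4. f x3 x4 * f x4 x0)"
  assumes V: "finite V" and n: "n = real (card V)" and cut: "cut_lower V f g \<kappa>"
    and gh: "\<And>x y. \<theta> * h x y \<le> g x y"
    and A: "A0 \<subseteq> V" "A1 \<subseteq> V" "A2 \<subseteq> V" "A3 \<subseteq> V" "A4 \<subseteq> V"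
    and f: "\<And>x y. 0 \<le> f x y" and h: "\<And>x y. 0 \<le> h x y" "\<And>x y. h x y \<le> 1"
    and \<kappa>: "0 \<le> \<kappa>" and \<theta>: "0 \<le> \<theta>" and d: "0 \<le> d" and D: "0 \<le> D"
    and d2: "\<And>x2. x2 \<in> A2 \<Longrightarrow> (\<Sum>x3\<in>A3. f x2 x3) \<le> d"
    and d4: "\<And>x4. x4 \<in> A4 \<Longrightarrow> (\<Sum>x0\<in>A0. f x4 x0) \<le> d"
    and D1: "(\<Sum>x1\<in>A1. \<Sum>x3\<in>A3. P x1 x3 - min (P x1 x3) 1) \<le> D"
    and D2: "(\<Sum>x3\<in>A3. \<Sum>x0\<in>A0. P' x3 x0 - min (P' x3 x0) 1) \<le> D"
  shows "\<theta>^5 * (\<Sum>x1\<in>A1. \<Sum>x2\<in>A2. \<Sum>x3\<in>A3. \<Sum>x4\<in>A4. \<Sum>x0\<in>A0. h x0 x1 * h x1 x2 * h x2 x3 * h x3 x4 * h x4 x0)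
      - (n * \<kappa> + \<theta> * (n * D + n * (d * \<kappa>) + \<theta> * (n^2 * \<kappa> + \<theta> * (n^2 * D + n^2 * (d * \<kappa>) + \<theta> * (n^3 * \<kappa>)))))
    \<le> (\<Sum>x3\<in>A3. \<Sum>x0\<in>A0. \<Sum>x1\<in>A1. f x0 x1 * P x1 x3 * P' x3 x0)"
proof -
  define p where "p = (\<lambda>x y. min (P x y) 1)"
  define p' where "p' = (\<lambda>x y. min (P' x y) 1)"
  have P0: "0 \<le> P x y" "0 \<le> P' x y" for x y
    unfolding P_def P'_def using f by (auto intro!: sum_nonneg)
  have p: "0 \<le> p x y" "p x y \<le> 1" "p x y \<le> P x y" "0 \<le> p' x y" "p' x y \<le> 1" "p' x y \<le> P' x y" for x y
    unfolding p_def p'_def using P0 by auto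
  have n0: "0 \<le> n" using n by simp
  note repl = cut_lower_replace[where h = h and \<theta> = \<theta>, OF V cut gh]
  note ge_n = sum_ge_sub_card_mult[OF V, folded n]
  note le_n = sum_le_card_mult[OF V, folded n]
  \<comment> \<open>Consecutive sums differ by one move: trade \<open>x0 x1\<close>, uncap
    \<open>P\<close>, trade \<open>x1 x2\<close>, trade \<open>x2 x3\<close>, uncap
    \<open>P'\<close>, trade \<open>x3 x4\<close>, trade \<open>x4 x0\<close>.\<close>
  define N1 where "N1 = (\<Sum>x3\<in>A3. \<Sum>x0\<in>A0. \<Sum>x1\<in>A1. f x0 x1 * p x1 x3 * p' x3 x0)"
  define N2 where "N2 = (\<Sum>x3\<in>A3. \<Sum>x0\<in>A0. \<Sum>x1\<in>A1. h x0 x1 * p x1 x3 * p' x3 x0)"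
  define N3 where "N3 = (\<Sum>x3\<in>A3. \<Sum>x0\<in>A0. \<Sum>x1\<in>A1. h x0 x1 * P x1 x3 * p' x3 x0)"
  define N4 where "N4 = (\<Sum>x0\<in>A0. \<Sum>x1\<in>A1. \<Sum>x2\<in>A2. h x1 x2 * h x0 x1 * (\<Sum>x3\<in>A3. f x2 x3 * p' x3 x0))"
  define N5 where "N5 = (\<Sum>x0\<in>A0. \<Sum>x2\<in>A2. \<Sum>x3\<in>A3. h x2 x3 * (\<Sum>x1\<in>A1. h x0 x1 * h x1 x2) * p' x3 x0)"
  define N6 where "N6 = (\<Sum>x0\<in>A0. \<Sum>x2\<in>A2. \<Sum>x3\<in>A3. h x2 x3 * (\<Sum>x1\<in>A1. h x0 x1 * h x1 x2) * P' x3 x0)"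
  define N7 where "N7 = (\<Sum>x1\<in>A1. \<Sum>x2\<in>A2. \<Sum>x3\<in>A3. \<Sum>x4\<in>A4. h x3 x4 * (h x1 x2 * h x2 x3) * (\<Sum>x0\<in>A0. h x0 x1 * f x4 x0))"
  define N8 where "N8 = (\<Sum>x1\<in>A1. \<Sum>x2\<in>A2. \<Sum>x3\<in>A3. \<Sum>x4\<in>A4. \<Sum>x0\<in>A0. h x4 x0 * (h x1 x2 * h x2 x3 * h x3 x4) * h x0 x1)"
  have s1: "N1 \<le> (\<Sum>x3\<in>A3. \<Sum>x0\<in>A0. \<Sum>x1\<in>A1. f x0 x1 * P x1 x3 * P' x3 x0)"
    unfolding N1_def using f p P0 by (intro sum_mono mult_mono) auto
  have s2: "\<theta> * N2 - n * \<kappa> \<le> N1"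
    unfolding N1_def N2_def sum_distrib_left[of \<theta> _ A3]
  proof (rule ge_n[OF A(4) _ \<kappa>])
    \<comment> \<open>For fixed \<open>x3\<close> the two capped counts are weights of
      \<open>x0\<close> and of \<open>x1\<close> alone, both at most \<open>1\<close>.\<close>
    fix x3
    show "\<theta> * (\<Sum>x0\<in>A0. \<Sum>x1\<in>A1. h x0 x1 * p x1 x3 * p' x3 x0) - \<kappa>
        \<le> (\<Sum>x0\<in>A0. \<Sum>x1\<in>A1. f x0 x1 * p x1 x3 * p' x3 x0)"
      using repl[OF A(1,2), of "\<lambda>x0. p' x3 x0" 1 "\<lambda>x1. p x1 x3" 1] p
      by (simp add: mult_ac)
  qed
  have s3: "N3 - n * D \<le> N2"
  proof -
    have "N3 - N2 = (\<Sum>x3\<in>A3. \<Sum>x0\<in>A0. \<Sum>x1\<in>A1. h x0 x1 * (P x1 x3 - p x1 x3) * p' x3 x0)"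
      unfolding N3_def N2_def sum_subtractf[symmetric] by (simp add: algebra_simps)
    also have "\<dots> \<le> (\<Sum>x3\<in>A3. \<Sum>x0\<in>A0. \<Sum>x1\<in>A1. 1 * (P x1 x3 - p x1 x3) * 1)"
      using h p by (intro sum_mono mult_mono) (auto intro!: mult_nonneg_nonneg)
    also have "\<dots> = (\<Sum>x0\<in>A0. \<Sum>x1\<in>A1. \<Sum>x3\<in>A3. P x1 x3 - p x1 x3)"
      by (subst sum.swap, subst sum_swap_depth1) simp
    also have "\<dots> \<le> n * D"
      by (rule le_n[OF A(1) _ D]) (use D1 in \<open>simp add: p_def\<close>)
    finally show ?thesis by simp
  qed
  have s4: "\<theta> * N4 - n * (d * \<kappa>) \<le> N3"
  proof -
    have "N3 = (\<Sum>x0\<in>A0. \<Sum>x1\<in>A1. \<Sum>x2\<in>A2. f x1 x2 * h x0 x1 * (\<Sum>x3\<in>A3. f x2 x3 * p' x3 x0))"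
    proof -
      have "N3 = (\<Sum>x0\<in>A0. \<Sum>x1\<in>A1. \<Sum>x3\<in>A3. h x0 x1 * P x1 x3 * p' x3 x0)"
        unfolding N3_def by (subst sum.swap) (rule sum_swap_depth1)
      also have "\<dots> = (\<Sum>x0\<in>A0. \<Sum>x1\<in>A1. \<Sum>x3\<in>A3. \<Sum>x2\<in>A2. f x1 x2 * h x0 x1 * (f x2 x3 * p' x3 x0))"
        unfolding P_def sum_distrib_left sum_distrib_right by (simp add: algebra_simps)
      also have "\<dots> = (\<Sum>x0\<in>A0. \<Sum>x1\<in>A1. \<Sum>x2\<in>A2. \<Sum>x3\<in>A3. f x1 x2 * h x0 x1 * (f x2 x3 * p' x3 x0))"
        by (rule sum_swap_depth2)
      finally show ?thesis unfolding sum_distrib_left .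
    qed
    moreover have "\<theta> * N4 - n * (d * \<kappa>) \<le> \<dots>"
      unfolding N4_def sum_distrib_left[of \<theta> _ A0]
    proof (rule ge_n[OF A(1)])
      fix x0
      \<comment> \<open>This weight of \<open>x2\<close> is at most a degree because the second path
        count is still capped; this is why \<open>P'\<close> is uncapped only later.\<close>
      have "(\<Sum>x3\<in>A3. f x2 x3 * p' x3 x0) \<le> d" if "x2 \<in> A2" for x2
      proof -
        have "(\<Sum>x3\<in>A3. f x2 x3 * p' x3 x0) \<le> (\<Sum>x3\<in>A3. f x2 x3 * 1)"
          using f p by (intro sum_mono mult_left_mono) auto
        then show ?thesis using d2[OF that] by simp
      qed
      then show "\<theta> * (\<Sum>x1\<in>A1. \<Sum>x2\<in>A2. h x1 x2 * h x0 x1 * (\<Sum>x3\<in>A3. f x2 x3 * p' x3 x0)) - d * \<kappa>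
        \<le> (\<Sum>x1\<in>A1. \<Sum>x2\<in>A2. f x1 x2 * h x0 x1 * (\<Sum>x3\<in>A3. f x2 x3 * p' x3 x0))"
        using repl[OF A(2,3), of "\<lambda>x1. h x0 x1" 1 "\<lambda>x2. \<Sum>x3\<in>A3. f x2 x3 * p' x3 x0" d] h d f p
        by (simp add: mult.commute sum_nonneg)
    qed (use d \<kappa> in simp)
    ultimately show ?thesis by simp
  qed
  \<comment> \<open>For fixed \<open>x0\<close>, the weight of \<open>x2\<close> in the trade of
    \<open>x2 x3\<close> is a path count in the dense graph, where the trivial bound
    \<open>n\<close> is good enough.\<close>
  have k: "0 \<le> (\<Sum>x1\<in>A1. h x0 x1 * h x1 x2)" "(\<Sum>x1\<in>A1. h x0 x1 * h x1 x2) \<le> n" for x0 x2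
  proof -
    show "0 \<le> (\<Sum>x1\<in>A1. h x0 x1 * h x1 x2)" using h by (intro sum_nonneg) auto
    show "(\<Sum>x1\<in>A1. h x0 x1 * h x1 x2) \<le> n"
      using le_n[OF A(2), of "\<lambda>x1. h x0 x1 * h x1 x2" 1] h by (simp add: mult_le_one)
  qed
  have s5: "\<theta> * N5 - n^2 * \<kappa> \<le> N4"
  proof -
    have "N4 = (\<Sum>x0\<in>A0. \<Sum>x2\<in>A2. \<Sum>x3\<in>A3. f x2 x3 * (\<Sum>x1\<in>A1. h x0 x1 * h x1 x2) * p' x3 x0)"
    proof (unfold N4_def, rule sum.cong[OF refl])
      fix x0
      have "(\<Sum>x1\<in>A1. \<Sum>x2\<in>A2. h x1 x2 * h x0 x1 * (\<Sum>x3\<in>A3. f x2 x3 * p' x3 x0))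
          = (\<Sum>x2\<in>A2. \<Sum>x1\<in>A1. \<Sum>x3\<in>A3. f x2 x3 * (h x0 x1 * h x1 x2) * p' x3 x0)"
        unfolding sum_distrib_left by (subst sum.swap) (simp add: algebra_simps)
      also have "\<dots> = (\<Sum>x2\<in>A2. \<Sum>x3\<in>A3. \<Sum>x1\<in>A1. f x2 x3 * (h x0 x1 * h x1 x2) * p' x3 x0)"
        by (rule sum_swap_depth1)
      finally show "(\<Sum>x1\<in>A1. \<Sum>x2\<in>A2. h x1 x2 * h x0 x1 * (\<Sum>x3\<in>A3. f x2 x3 * p' x3 x0))
          = (\<Sum>x2\<in>A2. \<Sum>x3\<in>A3. f x2 x3 * (\<Sum>x1\<in>A1. h x0 x1 * h x1 x2) * p' x3 x0)"
        unfolding sum_distrib_left sum_distrib_right .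
    qed
    moreover have "\<theta> * N5 - n * (n * \<kappa>) \<le> \<dots>"
      unfolding N5_def sum_distrib_left[of \<theta> _ A0]
    proof (rule ge_n[OF A(1)])
      fix x0
      show "\<theta> * (\<Sum>x2\<in>A2. \<Sum>x3\<in>A3. h x2 x3 * (\<Sum>x1\<in>A1. h x0 x1 * h x1 x2) * p' x3 x0) - n * \<kappa>
        \<le> (\<Sum>x2\<in>A2. \<Sum>x3\<in>A3. f x2 x3 * (\<Sum>x1\<in>A1. h x0 x1 * h x1 x2) * p' x3 x0)"
        using repl[OF A(3,4), of "\<lambda>x2. \<Sum>x1\<in>A1. h x0 x1 * h x1 x2" n "\<lambda>x3. p' x3 x0" 1] k p n0
        by (simp add: mult.commute[of n])
    qed (use n0 \<kappa> in simp)
    ultimately show ?thesis by (simp add: power2_eq_square mult.assoc)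
  qed
  have s6: "N6 - n^2 * D \<le> N5"
  proof -
    have "N6 - N5 = (\<Sum>x0\<in>A0. \<Sum>x2\<in>A2. \<Sum>x3\<in>A3. h x2 x3 * (\<Sum>x1\<in>A1. h x0 x1 * h x1 x2) * (P' x3 x0 - p' x3 x0))"
      unfolding N6_def N5_def sum_subtractf[symmetric] by (simp add: right_diff_distrib)
    also have "\<dots> \<le> (\<Sum>x0\<in>A0. \<Sum>x2\<in>A2. \<Sum>x3\<in>A3. 1 * n * (P' x3 x0 - p' x3 x0))"
      using h p k n0 by (intro sum_mono mult_mono) (auto intro!: mult_nonneg_nonneg)
    also have "\<dots> = (\<Sum>x2\<in>A2. n * (\<Sum>x3\<in>A3. \<Sum>x0\<in>A0. P' x3 x0 - p' x3 x0))"
      unfolding sum_distrib_left by (subst sum.swap, subst sum_swap_depth1) simp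
    also have "\<dots> \<le> n * (n * D)"
      by (rule le_n[OF A(3)]) (use D2 n0 D in \<open>auto simp: p'_def intro!: mult_left_mono\<close>)
    finally show ?thesis by (simp add: power2_eq_square mult.assoc)
  qed
  have s7: "\<theta> * N7 - n^2 * (d * \<kappa>) \<le> N6"
  proof -
    have "N6 = (\<Sum>x1\<in>A1. \<Sum>x2\<in>A2. \<Sum>x3\<in>A3. \<Sum>x4\<in>A4. f x3 x4 * (h x1 x2 * h x2 x3) * (\<Sum>x0\<in>A0. h x0 x1 * f x4 x0))"
    proof -
      let ?t = "\<lambda>x0 x1 x2 x3 x4. f x3 x4 * (h x1 x2 * h x2 x3) * (h x0 x1 * f x4 x0)"
      have "N6 = (\<Sum>x0\<in>A0. \<Sum>x2\<in>A2. \<Sum>x3\<in>A3. \<Sum>x1\<in>A1. \<Sum>x4\<in>A4. ?t x0 x1 x2 x3 x4)"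
        unfolding N6_def P'_def sum_distrib_left sum_distrib_right
        by (subst sum_swap_depth3) (simp add: algebra_simps)
      also have "\<dots> = (\<Sum>x0\<in>A0. \<Sum>x2\<in>A2. \<Sum>x1\<in>A1. \<Sum>x3\<in>A3. \<Sum>x4\<in>A4. ?t x0 x1 x2 x3 x4)"
        by (rule sum_swap_depth2)
      also have "\<dots> = (\<Sum>x0\<in>A0. \<Sum>x1\<in>A1. \<Sum>x2\<in>A2. \<Sum>x3\<in>A3. \<Sum>x4\<in>A4. ?t x0 x1 x2 x3 x4)"
        by (rule sum_swap_depth1)
      also have "\<dots> = (\<Sum>x1\<in>A1. \<Sum>x0\<in>A0. \<Sum>x2\<in>A2. \<Sum>x3\<in>A3. \<Sum>x4\<in>A4. ?t x0 x1 x2 x3 x4)"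
        by (rule sum.swap)
      also have "\<dots> = (\<Sum>x1\<in>A1. \<Sum>x2\<in>A2. \<Sum>x0\<in>A0. \<Sum>x3\<in>A3. \<Sum>x4\<in>A4. ?t x0 x1 x2 x3 x4)"
        by (rule sum_swap_depth1)
      also have "\<dots> = (\<Sum>x1\<in>A1. \<Sum>x2\<in>A2. \<Sum>x3\<in>A3. \<Sum>x0\<in>A0. \<Sum>x4\<in>A4. ?t x0 x1 x2 x3 x4)"
        by (rule sum_swap_depth2)
      also have "\<dots> = (\<Sum>x1\<in>A1. \<Sum>x2\<in>A2. \<Sum>x3\<in>A3. \<Sum>x4\<in>A4. \<Sum>x0\<in>A0. ?t x0 x1 x2 x3 x4)"
        by (rule sum_swap_depth3)
      finally show ?thesis unfolding sum_distrib_left .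
    qed
    moreover have "\<theta> * N7 - n * (n * (d * \<kappa>)) \<le> \<dots>"
      unfolding N7_def sum_distrib_left[of \<theta> _ A1]
    proof (rule ge_n[OF A(2)])
      fix x1
      show "\<theta> * (\<Sum>x2\<in>A2. \<Sum>x3\<in>A3. \<Sum>x4\<in>A4. h x3 x4 * (h x1 x2 * h x2 x3) * (\<Sum>x0\<in>A0. h x0 x1 * f x4 x0)) - n * (d * \<kappa>)
        \<le> (\<Sum>x2\<in>A2. \<Sum>x3\<in>A3. \<Sum>x4\<in>A4. f x3 x4 * (h x1 x2 * h x2 x3) * (\<Sum>x0\<in>A0. h x0 x1 * f x4 x0))"
        unfolding sum_distrib_left[of \<theta> _ A2]
      proof (rule ge_n[OF A(3)])
        fix x2
        have "(\<Sum>x0\<in>A0. h x0 x1 * f x4 x0) \<le> d" if "x4 \<in> A4" for x4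
        proof -
          have "(\<Sum>x0\<in>A0. h x0 x1 * f x4 x0) \<le> (\<Sum>x0\<in>A0. 1 * f x4 x0)"
            using f h by (intro sum_mono mult_right_mono) auto
          then show ?thesis using d4[OF that] by simp
        qed
        then show "\<theta> * (\<Sum>x3\<in>A3. \<Sum>x4\<in>A4. h x3 x4 * (h x1 x2 * h x2 x3) * (\<Sum>x0\<in>A0. h x0 x1 * f x4 x0)) - d * \<kappa>
          \<le> (\<Sum>x3\<in>A3. \<Sum>x4\<in>A4. f x3 x4 * (h x1 x2 * h x2 x3) * (\<Sum>x0\<in>A0. h x0 x1 * f x4 x0))"
          using repl[OF A(4,5), of "\<lambda>x3. h x1 x2 * h x2 x3" 1 "\<lambda>x4. \<Sum>x0\<in>A0. h x0 x1 * f x4 x0" d] h d f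
          by (simp add: mult.commute[of d] sum_nonneg mult_le_one)
      qed (use d \<kappa> in simp)
    qed (use n0 d \<kappa> in simp)
    ultimately show ?thesis by (simp add: power2_eq_square mult.assoc)
  qed
  have s8: "\<theta> * N8 - n^3 * \<kappa> \<le> N7"
  proof -
    have "N7 = (\<Sum>x1\<in>A1. \<Sum>x2\<in>A2. \<Sum>x3\<in>A3. \<Sum>x4\<in>A4. \<Sum>x0\<in>A0. f x4 x0 * (h x1 x2 * h x2 x3 * h x3 x4) * h x0 x1)"
      unfolding N7_def sum_distrib_left by (simp add: algebra_simps)
    moreover have "\<theta> * N8 - n * (n * (n * \<kappa>)) \<le> \<dots>"
      unfolding N8_def sum_distrib_left[of \<theta> _ A1]
    proof (rule ge_n[OF A(2)])
      fix x1
      show "\<theta> * (\<Sum>x2\<in>A2. \<Sum>x3\<in>A3. \<Sum>x4\<in>A4. \<Sum>x0\<in>A0. h x4 x0 * (h x1 x2 * h x2 x3 * h x3 x4) * h x0 x1) - n * (n * \<kappa>)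
        \<le> (\<Sum>x2\<in>A2. \<Sum>x3\<in>A3. \<Sum>x4\<in>A4. \<Sum>x0\<in>A0. f x4 x0 * (h x1 x2 * h x2 x3 * h x3 x4) * h x0 x1)"
        unfolding sum_distrib_left[of \<theta> _ A2]
      proof (rule ge_n[OF A(3)])
        fix x2
        show "\<theta> * (\<Sum>x3\<in>A3. \<Sum>x4\<in>A4. \<Sum>x0\<in>A0. h x4 x0 * (h x1 x2 * h x2 x3 * h x3 x4) * h x0 x1) - n * \<kappa>
          \<le> (\<Sum>x3\<in>A3. \<Sum>x4\<in>A4. \<Sum>x0\<in>A0. f x4 x0 * (h x1 x2 * h x2 x3 * h x3 x4) * h x0 x1)"
          unfolding sum_distrib_left[of \<theta> _ A3]
        proof (rule ge_n[OF A(4)])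
          fix x3
          show "\<theta> * (\<Sum>x4\<in>A4. \<Sum>x0\<in>A0. h x4 x0 * (h x1 x2 * h x2 x3 * h x3 x4) * h x0 x1) - \<kappa>
            \<le> (\<Sum>x4\<in>A4. \<Sum>x0\<in>A0. f x4 x0 * (h x1 x2 * h x2 x3 * h x3 x4) * h x0 x1)"
            using repl[OF A(5,1), of "\<lambda>x4. h x1 x2 * h x2 x3 * h x3 x4" 1 "\<lambda>x0. h x0 x1" 1] h
            by (simp add: mult_le_one)
        qed (use \<kappa> in simp)
      qed (use n0 \<kappa> in simp)
    qed (use n0 \<kappa> in simp)
    ultimately show ?thesis by (simp add: power3_eq_cube mult.assoc)
  qed
  have N8: "N8 = (\<Sum>x1\<in>A1. \<Sum>x2\<in>A2. \<Sum>x3\<in>A3. \<Sum>x4\<in>A4. \<Sum>x0\<in>A0. h x0 x1 * h x1 x2 * h x2 x3 * h x3 x4 * h x4 x0)"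
    unfolding N8_def by (simp add: algebra_simps)
  \<comment> \<open>The chain is composed from its dense end; each further trade multiplies the
    accumulated error by \<open>\<theta>\<close>, whence the nested form of the bound.\<close>
  have t1: "\<theta> * N8 - n^3 * \<kappa> \<le> N7" by (rule s8)
  have t2: "\<theta> * (\<theta> * N8) - (n^2 * D + n^2 * (d * \<kappa>) + \<theta> * (n^3 * \<kappa>)) \<le> N5"
    using mult_left_mono[OF t1 \<theta>] s6 s7 by (simp add: algebra_simps)
  have t3: "\<theta> * (\<theta> * (\<theta> * N8)) - (n^2 * \<kappa> + \<theta> * (n^2 * D + n^2 * (d * \<kappa>) + \<theta> * (n^3 * \<kappa>))) \<le> N4"
    using mult_left_mono[OF t2 \<theta>] s5 by (simp add: algebra_simps)
  have t4: "\<theta> * (\<theta> * (\<theta> * (\<theta> * N8)))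
      - (n * D + n * (d * \<kappa>) + \<theta> * (n^2 * \<kappa> + \<theta> * (n^2 * D + n^2 * (d * \<kappa>) + \<theta> * (n^3 * \<kappa>)))) \<le> N2"
    using mult_left_mono[OF t3 \<theta>] s3 s4 by (simp add: algebra_simps)
  have "\<theta> * (\<theta> * (\<theta> * (\<theta> * (\<theta> * N8))))
      - (n * \<kappa> + \<theta> * (n * D + n * (d * \<kappa>) + \<theta> * (n^2 * \<kappa> + \<theta> * (n^2 * D + n^2 * (d * \<kappa>) + \<theta> * (n^3 * \<kappa>))))) \<le> N1"
    using mult_left_mono[OF t4 \<theta>] s2 by (simp add: algebra_simps)
  then show ?thesis
    using s1 unfolding N8[symmetric] by (simp add: numeral_eq_Suc mult.assoc)
qed

section \<open>Almost complete blocks and their disjoint pieces\<close>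

text \<open>Union bound: each of the five pairs is missing for at most a tenth of all 5-tuples, so
  at least half of the tuples form a closed walk.\<close>

lemma dense_C5_count:
  fixes h :: "'a \<Rightarrow> 'a \<Rightarrow> real"
  assumes h: "\<And>x y. h x y = 0 \<or> h x y = 1"
    and b: "(\<Sum>x\<in>A0. \<Sum>y\<in>A1. 1 - h x y) \<le> card A0 * card A1 / 10"
      "(\<Sum>x\<in>A1. \<Sum>y\<in>A2. 1 - h x y) \<le> card A1 * card A2 / 10"
      "(\<Sum>x\<in>A2. \<Sum>y\<in>A3. 1 - h x y) \<le> card A2 * card A3 / 10"
      "(\<Sum>x\<in>A3. \<Sum>y\<in>A4. 1 - h x y) \<le> card A3 * card A4 / 10"
      "(\<Sum>x\<in>A4. \<Sum>y\<in>A0. 1 - h x y) \<le> card A4 * card A0 / 10"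
  shows "real (card A0) * card A1 * card A2 * card A3 * card A4 / 2
    \<le> (\<Sum>x1\<in>A1. \<Sum>x2\<in>A2. \<Sum>x3\<in>A3. \<Sum>x4\<in>A4. \<Sum>x0\<in>A0. h x0 x1 * h x1 x2 * h x2 x3 * h x3 x4 * h x4 x0)"
proof -
  define a0 a1 a2 a3 a4 where "a0 = real (card A0)" and "a1 = real (card A1)" and "a2 = real (card A2)"
    and "a3 = real (card A3)" and "a4 = real (card A4)"
  note a_def = a0_def a1_def a2_def a3_def a4_def
  define q where "q = (\<lambda>x y. 1 - h x y)"
  have pos: "0 \<le> a0" "0 \<le> a1" "0 \<le> a2" "0 \<le> a3" "0 \<le> a4" by (simp_all add: a_def)
  let ?S = "\<lambda>F. \<Sum>x1\<in>A1. \<Sum>x2\<in>A2. \<Sum>x3\<in>A3. \<Sum>x4\<in>A4. \<Sum>x0\<in>A0. (F x0 x1 x2 x3 x4 :: real)"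
  have e1: "?S (\<lambda>x0 x1 x2 x3 x4. 1) = a0 * a1 * a2 * a3 * a4"
    by (simp add: a_def)
  have "?S (\<lambda>x0 x1 x2 x3 x4. q x0 x1) = (a2 * a3 * a4) * (\<Sum>x0\<in>A0. \<Sum>x1\<in>A1. q x0 x1)"
    by (subst (2) sum.swap) (simp add: a_def sum_distrib_left mult.assoc)
  also have "\<dots> \<le> (a2 * a3 * a4) * (a0 * a1 / 10)"
    using b(1) pos unfolding q_def a_def by (intro mult_left_mono) auto
  finally have q01: "?S (\<lambda>x0 x1 x2 x3 x4. q x0 x1) \<le> (a0 * a1 * a2 * a3 * a4) / 10" by (simp add: mult_ac)
  have "?S (\<lambda>x0 x1 x2 x3 x4. q x1 x2) = (a3 * a4 * a0) * (\<Sum>x1\<in>A1. \<Sum>x2\<in>A2. q x1 x2)"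
    by (simp add: a_def sum_distrib_left mult.assoc)
  also have "\<dots> \<le> (a3 * a4 * a0) * (a1 * a2 / 10)"
    using b(2) pos unfolding q_def a_def by (intro mult_left_mono) auto
  finally have q12: "?S (\<lambda>x0 x1 x2 x3 x4. q x1 x2) \<le> (a0 * a1 * a2 * a3 * a4) / 10" by (simp add: mult_ac)
  have "?S (\<lambda>x0 x1 x2 x3 x4. q x2 x3) = (a1 * a4 * a0) * (\<Sum>x2\<in>A2. \<Sum>x3\<in>A3. q x2 x3)"
    by (simp add: a_def sum_distrib_left mult.assoc)
  also have "\<dots> \<le> (a1 * a4 * a0) * (a2 * a3 / 10)"
    using b(3) pos unfolding q_def a_def by (intro mult_left_mono) auto
  finally have q23: "?S (\<lambda>x0 x1 x2 x3 x4. q x2 x3) \<le> (a0 * a1 * a2 * a3 * a4) / 10" by (simp add: mult_ac)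
  have "?S (\<lambda>x0 x1 x2 x3 x4. q x3 x4) = (a1 * a2 * a0) * (\<Sum>x3\<in>A3. \<Sum>x4\<in>A4. q x3 x4)"
    by (simp add: a_def sum_distrib_left mult.assoc)
  also have "\<dots> \<le> (a1 * a2 * a0) * (a3 * a4 / 10)"
    using b(4) pos unfolding q_def a_def by (intro mult_left_mono) auto
  finally have q34: "?S (\<lambda>x0 x1 x2 x3 x4. q x3 x4) \<le> (a0 * a1 * a2 * a3 * a4) / 10" by (simp add: mult_ac)
  have "?S (\<lambda>x0 x1 x2 x3 x4. q x4 x0) = (a1 * a2 * a3) * (\<Sum>x4\<in>A4. \<Sum>x0\<in>A0. q x4 x0)"
    by (simp add: a_def sum_distrib_left mult.assoc)
  also have "\<dots> \<le> (a1 * a2 * a3) * (a4 * a0 / 10)"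
    using b(5) pos unfolding q_def a_def by (intro mult_left_mono) auto
  finally have q40: "?S (\<lambda>x0 x1 x2 x3 x4. q x4 x0) \<le> (a0 * a1 * a2 * a3 * a4) / 10" by (simp add: mult_ac)
  have "?S (\<lambda>x0 x1 x2 x3 x4. 1) - ?S (\<lambda>x0 x1 x2 x3 x4. q x0 x1) - ?S (\<lambda>x0 x1 x2 x3 x4. q x1 x2)
      - ?S (\<lambda>x0 x1 x2 x3 x4. q x2 x3) - ?S (\<lambda>x0 x1 x2 x3 x4. q x3 x4) - ?S (\<lambda>x0 x1 x2 x3 x4. q x4 x0)
    = ?S (\<lambda>x0 x1 x2 x3 x4. 1 - q x0 x1 - q x1 x2 - q x2 x3 - q x3 x4 - q x4 x0)"
    by (simp only: sum_subtractf)
  also have "\<dots> \<le> ?S (\<lambda>x0 x1 x2 x3 x4. h x0 x1 * h x1 x2 * h x2 x3 * h x3 x4 * h x4 x0)"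
  proof (intro sum_mono)
    fix x0 x1 x2 x3 x4
    show "1 - q x0 x1 - q x1 x2 - q x2 x3 - q x3 x4 - q x4 x0
        \<le> h x0 x1 * h x1 x2 * h x2 x3 * h x3 x4 * h x4 x0"
      using h[of x0 x1] h[of x1 x2] h[of x2 x3] h[of x3 x4] h[of x4 x0]
      by (elim disjE) (simp_all add: q_def)
  qed
  finally show ?thesis
    using e1 q01 q12 q23 q34 q40 unfolding a_def by linarith
qed

text \<open>Consecutive runs of an enumeration of \<open>W\<close>. They allow the vertices of a
  closed walk to be placed in disjoint sets even when some of their atoms coincide, so that genuine
  5-cycles are counted.\<close>

lemma disjoint_pieces:
  assumes "finite W"
  shows "\<exists>B :: nat \<Rightarrow> 'a set. (\<forall>i<5. B i \<subseteq> W \<and> card (B i) = card W div 5)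
    \<and> (\<forall>i<5. \<forall>j<5. i \<noteq> j \<longrightarrow> B i \<inter> B j = {})"
proof -
  define m where "m = card W div 5"
  obtain \<phi> where \<phi>: "bij_betw \<phi> {0..<card W} W"
    using ex_bij_betw_nat_finite[OF assms] by blast
  define I where "I = (\<lambda>i. {i * m..<(i + 1) * m})"
  have I: "I i \<subseteq> {0..<card W}" if "i < 5" for i
  proof -
    have "(i + 1) * m \<le> 5 * m" using that by (intro mult_le_mono1) simp
    also have "\<dots> \<le> card W" by (simp add: m_def)
    finally show ?thesis by (auto simp: I_def)
  qed
  have inj: "inj_on \<phi> {0..<card W}" and im: "\<phi> ` {0..<card W} = W"
    using \<phi> by (auto simp: bij_betw_def)
  have disj: "I i \<inter> I j = {}" if "i < j" for i j
  proof -
    have "(i + 1) * m \<le> j * m" using that by (intro mult_le_mono1) simp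
    then show ?thesis by (auto simp: I_def)
  qed
  have disj': "I i \<inter> I j = {}" if "i \<noteq> j" for i j
    using disj[of i j] disj[of j i] that by (cases "i < j") auto
  show ?thesis
  proof (intro exI[of _ "\<lambda>i. \<phi> ` I i"] conjI allI impI)
    fix i :: nat assume i: "i < 5"
    show "\<phi> ` I i \<subseteq> W" using I[OF i] im by blast
    show "card (\<phi> ` I i) = card W div 5"
      using card_image[OF inj_on_subset[OF inj I[OF i]]] by (simp add: I_def m_def)
    fix j :: nat assume j: "j < 5" "i \<noteq> j"
    show "\<phi> ` I i \<inter> \<phi> ` I j = {}"
      using inj_on_image_Int[OF inj I[OF i] I[OF j(1)]] disj'[OF j(2)] by simp
  qed
qed

text \<open>The choice depends on the set \<open>W\<close> alone: vertices in a common atom must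
  share one division, otherwise pieces with different indices could overlap.\<close>

definition pieces :: "'a set \<Rightarrow> nat \<Rightarrow> 'a set" where
  "pieces W = (SOME B. (\<forall>i<5. B i \<subseteq> W \<and> card (B i) = card W div 5)
    \<and> (\<forall>i<5. \<forall>j<5. i \<noteq> j \<longrightarrow> B i \<inter> B j = {}))"

lemma pieces:
  assumes "finite W" "i < 5"
  shows "pieces W i \<subseteq> W" "card (pieces W i) = card W div 5"
    and "j < 5 \<Longrightarrow> i \<noteq> j \<Longrightarrow> pieces W i \<inter> pieces W j = {}"
  using someI_ex[OF disjoint_pieces[OF assms(1)], folded pieces_def] assms(2) by auto

section \<open>Graphs with few 4-cycles\<close>

locale fin_graph =
  fixes V :: "'a set" and f :: "'a \<Rightarrow> 'a \<Rightarrow> real"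
  assumes fin: "finite V" and f01: "\<And>x y. f x y = 0 \<or> f x y = 1" and sym: "\<And>x y. f x y = f y x"
    and irrefl: "\<And>x. f x x = 0"
begin

definition codeg :: "'a \<Rightarrow> 'a \<Rightarrow> real" where
  "codeg x y = (\<Sum>z\<in>V. f x z * f y z)"

text \<open>Ordered pairs of distinct vertices, each with the ordered pairs of distinct common
  neighbours: every 4-cycle in \<open>V\<close> is counted eight times.\<close>

definition C4_sum :: real where
  "C4_sum = (\<Sum>x\<in>V. \<Sum>y\<in>V - {x}. codeg x y * (codeg x y - 1))"

definition cycle_lists :: "nat \<Rightarrow> 'a list set" where
  "cycle_lists k = {xs. length xs = k \<and> distinct xs \<and> set xs \<subseteq> V \<and>
     (\<forall>i<k. f (xs ! i) (xs ! ((i + 1) mod k)) = 1)}"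

lemma cycle_lists_4:
  "[a, b, c, d] \<in> cycle_lists 4 \<longleftrightarrow> distinct [a, b, c, d] \<and> set [a, b, c, d] \<subseteq> V \<and>
     f a b = 1 \<and> f b c = 1 \<and> f c d = 1 \<and> f d a = 1"
proof -
  have "(\<forall>i<4. Q i) \<longleftrightarrow> Q 0 \<and> Q 1 \<and> Q 2 \<and> Q 3" for Q :: "nat \<Rightarrow> bool"
    by (simp add: numeral_eq_Suc All_less_Suc) blast
  then show ?thesis by (simp add: cycle_lists_def)
qed

lemma cycle_lists_5:
  "[a, b, c, d, e] \<in> cycle_lists 5 \<longleftrightarrow> distinct [a, b, c, d, e] \<and> set [a, b, c, d, e] \<subseteq> V \<and>
     f a b = 1 \<and> f b c = 1 \<and> f c d = 1 \<and> f d e = 1 \<and> f e a = 1"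
proof -
  have "(\<forall>i<5. Q i) \<longleftrightarrow> Q 0 \<and> Q 1 \<and> Q 2 \<and> Q 3 \<and> Q 4" for Q :: "nat \<Rightarrow> bool"
    by (simp add: numeral_eq_Suc All_less_Suc) blast
  then show ?thesis by (simp add: cycle_lists_def)
qed

lemma finite_cycle_lists: "finite (cycle_lists k)"
proof -
  have "cycle_lists k \<subseteq> {xs. set xs \<subseteq> V \<and> length xs = k}" by (auto simp: cycle_lists_def)
  then show ?thesis using finite_lists_length_eq[OF fin] finite_subset by blast
qed

section \<open>Codegrees and the number of 4-cycles\<close>

lemma f_nonneg: "0 \<le> f x y" and f_le1: "f x y \<le> 1"
  using f01[of x y] by auto

lemma sum_ff_eq_card:
  assumes "finite A"
  shows "(\<Sum>z\<in>A. f x z * f y z) = real (card {z\<in>A. f x z = 1 \<and> f y z = 1})"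
proof -
  have "(\<Sum>z\<in>A. f x z * f y z) = (\<Sum>z\<in>A. if f x z = 1 \<and> f y z = 1 then 1 else 0)"
  proof (rule sum.cong[OF refl])
    fix z show "f x z * f y z = (if f x z = 1 \<and> f y z = 1 then 1 else 0)"
      using f01[of x z] f01[of y z] by auto
  qed
  also have "\<dots> = real (card {z\<in>A. f x z = 1 \<and> f y z = 1})"
    using assms by (simp add: sum.inter_filter[symmetric])
  finally show ?thesis .
qed

lemma codeg_excess_nonneg: "0 \<le> codeg x y * (codeg x y - 1)"
proof -
  obtain k :: nat where "codeg x y = real k"
    unfolding codeg_def using sum_ff_eq_card[OF fin] by blast
  then show ?thesis by (cases k) auto
qed

text \<open>Path counts are integers: the excess over \<open>1\<close> vanishes for counts
  \<open>0\<close> and \<open>1\<close>, and otherwise \<open>k - 1\<close> is at most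
  \<open>k * (k - 1)\<close>. So few 4-cycles force path counts to be essentially
  0/1-valued.\<close>

lemma restricted_codeg_excess:
  assumes "A \<subseteq> V"
  shows "(\<Sum>z\<in>A. f x z * f z y) - min (\<Sum>z\<in>A. f x z * f z y) 1 \<le> codeg x y * (codeg x y - 1)"
proof -
  have fA: "finite A" using assms fin finite_subset by blast
  define j where "j = card {z\<in>A. f x z = 1 \<and> f y z = 1}"
  define k where "k = card {z\<in>V. f x z = 1 \<and> f y z = 1}"
  have "j \<le> k" unfolding j_def k_def using fin assms by (intro card_mono) auto
  have "(\<Sum>z\<in>A. f x z * f z y) = real j"
    using sum_ff_eq_card[OF fA, of x y] by (simp add: j_def sym[of _ y])
  moreover have "codeg x y = real k"
    unfolding codeg_def k_def by (rule sum_ff_eq_card[OF fin])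
  moreover have "real j - min (real j) 1 \<le> real k * (real k - 1)"
  proof (cases "j \<le> 1")
    case True
    then show ?thesis by (cases k) auto
  next
    case False
    then have k: "1 \<le> real k" using \<open>j \<le> k\<close> by simp
    have "real j - min (real j) 1 \<le> 1 * (real k - 1)" using False \<open>j \<le> k\<close> by simp
    also have "\<dots> \<le> real k * (real k - 1)" using k by (intro mult_right_mono) auto
    finally show ?thesis .
  qed
  ultimately show ?thesis by simp
qed

text \<open>Disjointness of \<open>A\<close> and \<open>C\<close> avoids the diagonal, where the
  codegree is a degree and is not controlled by 4-cycles.\<close>

lemma restricted_codeg_excess_sum:
  assumes "A \<subseteq> V" "B \<subseteq> V" "C \<subseteq> V" "A \<inter> C = {}"
  shows "(\<Sum>x\<in>A. \<Sum>y\<in>C. (\<Sum>z\<in>B. f x z * f z y) - min (\<Sum>z\<in>B. f x z * f z y) 1) \<le> C4_sum"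
proof -
  have "(\<Sum>x\<in>A. \<Sum>y\<in>C. (\<Sum>z\<in>B. f x z * f z y) - min (\<Sum>z\<in>B. f x z * f z y) 1)
      \<le> (\<Sum>x\<in>A. \<Sum>y\<in>C. codeg x y * (codeg x y - 1))"
    by (intro sum_mono restricted_codeg_excess assms)
  also have "\<dots> \<le> (\<Sum>x\<in>A. \<Sum>y\<in>V - {x}. codeg x y * (codeg x y - 1))"
    using assms fin by (intro sum_mono sum_mono2) (auto simp: codeg_excess_nonneg)
  also have "\<dots> \<le> C4_sum"
    unfolding C4_sum_def using assms fin
    by (intro sum_mono2) (auto intro!: sum_nonneg simp: codeg_excess_nonneg)
  finally show ?thesis .
qed

text \<open>Expanding the square gives codegrees of pairs in \<open>S\<close>. The diagonal
  contributes the edges at \<open>S\<close>; an off-diagonal codegree is at most \<open>1\<close>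
  plus its contribution to \<open>C4_sum\<close>.\<close>

lemma sum_degree_square:
  assumes S: "S \<subseteq> V"
  shows "(\<Sum>y\<in>V. (\<Sum>x\<in>S. f x y)\<^sup>2) \<le> (real (card S))\<^sup>2 + C4_sum + (\<Sum>x\<in>S. \<Sum>y\<in>V. f x y)"
proof -
  have fS: "finite S" using S fin finite_subset by blast
  have "(\<Sum>y\<in>V. (\<Sum>x\<in>S. f x y)\<^sup>2) = (\<Sum>y\<in>V. \<Sum>x\<in>S. \<Sum>x'\<in>S. f x y * f x' y)"
    by (simp add: power2_eq_square sum_product)
  also have "\<dots> = (\<Sum>x\<in>S. \<Sum>x'\<in>S. codeg x x')"
    unfolding codeg_def by (subst sum.swap) (rule sum_swap_depth1)
  also have "\<dots> = (\<Sum>x\<in>S. codeg x x + (\<Sum>x'\<in>S - {x}. codeg x x'))"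
    using fS by (intro sum.cong refl) (simp add: sum.remove)
  also have "\<dots> = (\<Sum>x\<in>S. codeg x x) + (\<Sum>x\<in>S. \<Sum>x'\<in>S - {x}. codeg x x')"
    by (rule sum.distrib)
  also have "(\<Sum>x\<in>S. codeg x x) = (\<Sum>x\<in>S. \<Sum>y\<in>V. f x y)"
    unfolding codeg_def
  proof (intro sum.cong refl)
    fix x y show "f x y * f x y = f x y" using f01[of x y] by auto
  qed
  also have "(\<Sum>x\<in>S. \<Sum>x'\<in>S - {x}. codeg x x')
      \<le> (\<Sum>x\<in>S. \<Sum>x'\<in>S - {x}. 1 + codeg x x' * (codeg x x' - 1))"
  proof (intro sum_mono)
    fix x x'
    show "codeg x x' \<le> 1 + codeg x x' * (codeg x x' - 1)"
      using zero_le_power2[of "codeg x x' - 1"] by (simp add: power2_eq_square algebra_simps)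
  qed
  also have "\<dots> = (\<Sum>x\<in>S. \<Sum>x'\<in>S - {x}. 1) + (\<Sum>x\<in>S. \<Sum>x'\<in>S - {x}. codeg x x' * (codeg x x' - 1))"
    by (simp only: sum.distrib)
  also have "(\<Sum>x\<in>S. \<Sum>x'\<in>S - {x}. 1) \<le> (\<Sum>x\<in>S. \<Sum>x'\<in>S. (1::real))"
    using fS by (intro sum_mono sum_mono2) auto
  also have "\<dots> = (real (card S))\<^sup>2" by (simp add: power2_eq_square)
  also have "(\<Sum>x\<in>S. \<Sum>x'\<in>S - {x}. codeg x x' * (codeg x x' - 1))
      \<le> (\<Sum>x\<in>S. \<Sum>x'\<in>V - {x}. codeg x x' * (codeg x x' - 1))"
    using S fin by (intro sum_mono sum_mono2) (auto simp: codeg_excess_nonneg)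
  also have "\<dots> \<le> C4_sum"
    unfolding C4_sum_def using S fin
    by (intro sum_mono2) (auto intro!: sum_nonneg simp: codeg_excess_nonneg)
  finally show ?thesis by simp
qed

text \<open>Two endpoints \<open>x\<close>, \<open>y\<close> with two distinct common neighbours
  \<open>z\<close>, \<open>w\<close> give the 4-cycle list \<open>[x, z, y, w]\<close>,
  injectively.\<close>

lemma C4_sum_le_card: "C4_sum \<le> real (card (cycle_lists 4))"
proof -
  define R where "R = (\<lambda>x y. {(z, w). z \<in> V \<and> w \<in> V \<and> z \<noteq> w \<and>
    f x z = 1 \<and> f y z = 1 \<and> f x w = 1 \<and> f y w = 1})"
  define T where "T = (SIGMA x:V. SIGMA y:V - {x}. R x y)"
  have finR: "finite (R x y)" for x y
    by (rule finite_subset[of _ "V \<times> V"]) (auto simp: R_def fin)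
  have cR: "codeg x y * (codeg x y - 1) = real (card (R x y))" for x y
  proof -
    define N where "N = {z\<in>V. f x z = 1 \<and> f y z = 1}"
    have fN: "finite N" using fin by (simp add: N_def)
    have "R x y = (SIGMA z:N. N - {z})" by (auto simp: N_def R_def)
    moreover have "real (card (SIGMA z:N. N - {z})) = real (card N) * (real (card N) - 1)"
      using fN by (cases "card N") (auto simp: algebra_simps)
    moreover have "codeg x y = real (card N)"
      unfolding codeg_def N_def by (rule sum_ff_eq_card[OF fin])
    ultimately show ?thesis by simp
  qed
  have "C4_sum = real (card T)"
    unfolding C4_sum_def T_def cR using fin finR by simp
  moreover have "card T \<le> card (cycle_lists 4)"
  proof (rule card_inj_on_le)
    let ?F = "\<lambda>(x, y, z, w). [x, z, y, w]"
    show "inj_on ?F T" by (auto simp: inj_on_def)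
    show "?F ` T \<subseteq> cycle_lists 4"
    proof
      fix t assume "t \<in> ?F ` T"
      then obtain x y z w where t: "t = [x, z, y, w]" "x \<in> V" "y \<in> V" "x \<noteq> y" "z \<in> V" "w \<in> V"
        "z \<noteq> w" "f x z = 1" "f y z = 1" "f x w = 1" "f y w = 1"
        by (auto simp: T_def R_def)
      moreover from this have "x \<noteq> z" "y \<noteq> z" "x \<noteq> w" "y \<noteq> w" using irrefl by force+
      ultimately show "t \<in> cycle_lists 4" by (auto simp: cycle_lists_4 sym[of _ y] sym[of _ x])
    qed
  qed (rule finite_cycle_lists)
  ultimately show ?thesis by simp
qed

section \<open>Good blocks force many 5-cycles\<close>

text \<open>The expanded sum counts closed walks with one vertex in each part; disjoint parts make
  these vertices distinct.\<close>

lemma C5_sum_le_card: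
  assumes A: "A0 \<subseteq> V" "A1 \<subseteq> V" "A2 \<subseteq> V" "A3 \<subseteq> V" "A4 \<subseteq> V"
    and dis: "A0 \<inter> A1 = {}" "A0 \<inter> A2 = {}" "A0 \<inter> A3 = {}" "A0 \<inter> A4 = {}" "A1 \<inter> A2 = {}"
      "A1 \<inter> A3 = {}" "A1 \<inter> A4 = {}" "A2 \<inter> A3 = {}" "A2 \<inter> A4 = {}" "A3 \<inter> A4 = {}"
  shows "(\<Sum>x3\<in>A3. \<Sum>x0\<in>A0. \<Sum>x1\<in>A1. f x0 x1 * (\<Sum>x2\<in>A2. f x1 x2 * f x2 x3)
      * (\<Sum>x4\<in>A4. f x3 x4 * f x4 x0)) \<le> real (card (cycle_lists 5))"
proof -
  define X where "X = A3 \<times> A0 \<times> A1 \<times> A2 \<times> A4"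
  define T where "T = {(x3, x0, x1, x2, x4) \<in> X. f x0 x1 = 1 \<and> f x1 x2 = 1 \<and> f x2 x3 = 1
      \<and> f x3 x4 = 1 \<and> f x4 x0 = 1}"
  have finA: "finite A0" "finite A1" "finite A2" "finite A3" "finite A4"
    by (rule finite_subset[OF _ fin], rule A)+
  have finX: "finite X" by (simp add: X_def finA)
  have "(\<Sum>x3\<in>A3. \<Sum>x0\<in>A0. \<Sum>x1\<in>A1. f x0 x1 * (\<Sum>x2\<in>A2. f x1 x2 * f x2 x3)
      * (\<Sum>x4\<in>A4. f x3 x4 * f x4 x0))
    = (\<Sum>x3\<in>A3. \<Sum>x0\<in>A0. \<Sum>x1\<in>A1. \<Sum>x2\<in>A2. \<Sum>x4\<in>A4.
        f x0 x1 * (f x1 x2 * f x2 x3) * (f x3 x4 * f x4 x0))"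
    by (simp only: sum_distrib_left sum_distrib_right) (rule sum_swap_depth3)
  also have "\<dots> = (\<Sum>(x3, x0, x1, x2, x4)\<in>X. f x0 x1 * (f x1 x2 * f x2 x3) * (f x3 x4 * f x4 x0))"
    unfolding X_def by (simp only: sum.cartesian_product)
  also have "\<dots> = (\<Sum>t\<in>X. if t \<in> T then 1 else 0)"
  proof (rule sum.cong[OF refl], clarify)
    fix x3 x0 x1 x2 x4 assume t: "(x3, x0, x1, x2, x4) \<in> X"
    show "f x0 x1 * (f x1 x2 * f x2 x3) * (f x3 x4 * f x4 x0)
      = (if (x3, x0, x1, x2, x4) \<in> T then 1 else 0)"
      using t f01[of x0 x1] f01[of x1 x2] f01[of x2 x3] f01[of x3 x4] f01[of x4 x0]
      unfolding T_def by (elim disjE) simp_all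
  qed
  also have "\<dots> = real (card T)"
  proof -
    have "T = {t\<in>X. t \<in> T}" by (auto simp: T_def)
    then show ?thesis using finX by (simp add: sum.inter_filter[symmetric])
  qed
  also have "card T \<le> card (cycle_lists 5)"
  proof (rule card_inj_on_le)
    let ?F = "\<lambda>(x3, x0, x1, x2, x4). [x0, x1, x2, x3, x4]"
    show "inj_on ?F T" by (auto simp: inj_on_def)
    show "?F ` T \<subseteq> cycle_lists 5"
    proof
      fix t assume "t \<in> ?F ` T"
      then obtain x0 x1 x2 x3 x4 where t: "t = [x0, x1, x2, x3, x4]" and
        mem: "x0 \<in> A0" "x1 \<in> A1" "x2 \<in> A2" "x3 \<in> A3" "x4 \<in> A4" and
        e: "f x0 x1 = 1" "f x1 x2 = 1" "f x2 x3 = 1" "f x3 x4 = 1" "f x4 x0 = 1"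
        by (auto simp: T_def X_def)
      have "distinct [x0, x1, x2, x3, x4]" using mem dis by auto
      moreover have "set [x0, x1, x2, x3, x4] \<subseteq> V" using mem A by auto
      ultimately show "t \<in> cycle_lists 5" using e unfolding t cycle_lists_5 by blast
    qed
  qed (rule finite_cycle_lists)
  finally show ?thesis by simp
qed

text \<open>The thresholded function \<open>h\<close> is almost complete between the atoms along the
  walk, and remains so between pieces of a fifth of their size. The dense count on these pieces then
  feeds \<open>C5_counting\<close>.\<close>

lemma many_C5_of_good_blocks:
  fixes M c \<eta> \<delta> \<tau> s :: real and \<P> \<Q> :: "'a set set"
  defines "s \<equiv> sqrt (card V)"
  defines "g \<equiv> trunc V \<Q> f (c / s)"
  defines "good \<equiv> (\<lambda>x y. (\<Sum>u\<in>atom V \<P> x. \<Sum>v\<in>atom V \<P> y. if g u v < c / (2 * s) then 1 else 0)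
    \<le> real (card (atom V \<P> x)) * real (card (atom V \<P> y)) / 1000)"
  assumes c: "0 < c" "c \<le> 1" and M: "1 \<le> M" and \<eta>: "0 \<le> \<eta>" and \<delta>: "0 \<le> \<delta>"
    and deg: "\<And>x. x \<in> V \<Longrightarrow> (\<Sum>y\<in>V. f x y) \<le> M * s"
    and C4: "C4_sum \<le> \<delta> * real (card V)^2"
    and cut: "cut_lower V f g (\<eta> * card V * s)"
    and \<tau>: "0 < \<tau>" "24 \<le> \<tau> * card V"
    and x: "x0 \<in> V" "x1 \<in> V" "x2 \<in> V" "x3 \<in> V" "x4 \<in> V"
    and big: "\<And>x. x \<in> {x0, x1, x2, x3, x4} \<Longrightarrow> \<tau> * card V \<le> card (atom V \<P> x)"
    and good: "good x0 x1" "good x1 x2" "good x2 x3" "good x3 x4" "good x4 x0"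
  shows "((c * \<tau> / 12)^5 / 2 - 5 * M * \<eta> - 2 * \<delta>) * s^5 \<le> real (card (cycle_lists 5))"
proof -
  define n where "n = real (card V)"
  define e where "e = c / 2"
  define \<theta> where "\<theta> = e / s"
  define \<kappa> where "\<kappa> = \<eta> * n * s"
  define h where "h = (\<lambda>u v. if g u v < c / (2 * s) then 0 else (1::real))"
  have npos: "0 < n" using x(1) fin by (auto simp: n_def card_gt_0_iff)
  then have spos: "0 < s" by (simp add: s_def n_def)
  have ns: "n = s^2" by (simp add: s_def n_def)
  have epos: "0 < e" "e \<le> 1" using c by (auto simp: e_def)
  have \<theta>: "0 < \<theta>" using epos spos by (simp add: \<theta>_def)
  have th: "c / (2 * s) = \<theta>" by (simp add: \<theta>_def e_def)
  have gh: "\<theta> * h u v \<le> g u v" for u v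
  proof -
    have "0 \<le> g u v" unfolding g_def using c spos by (intro trunc_nonneg f_nonneg) auto
    then show ?thesis by (auto simp: h_def th)
  qed
  define W where "W = atom V \<P>"
  have finW: "finite (W x)" for x unfolding W_def by (rule finite_atom[OF fin])
  have WV: "W x \<subseteq> V" for x unfolding W_def by (rule atom_subset)
  define A where "A = (\<lambda>x i. pieces (W x) i)"
  have AW: "A x i \<subseteq> W x" if "i < 5" for x i unfolding A_def using pieces(1)[OF finW that] .
  have AV: "A x i \<subseteq> V" if "i < 5" for x i using AW[OF that] WV by blast
  have disj: "A x i \<inter> A y j = {}" if "i < 5" "j < 5" "i \<noteq> j" for x y i j
  proof (cases "W x = W y")
    case True
    then show ?thesis unfolding A_def using pieces(3)[OF finW that] by simp
  next
    case False
    then have "W x \<inter> W y = {}" unfolding W_def using atom_eq by (metis disjoint_iff)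
    then show ?thesis using AW that by blast
  qed
  have cA: "real (card (W x)) \<le> 6 * real (card (A x i))" "\<tau> * n / 6 \<le> real (card (A x i))"
    if "x \<in> {x0, x1, x2, x3, x4}" "i < 5" for x i
  proof -
    have b: "24 \<le> real (card (W x))" "\<tau> * n \<le> real (card (W x))"
      using big[OF that(1)] \<tau>(2) by (simp_all add: W_def n_def)
    then have "24 \<le> card (W x)" by simp
    \<comment> \<open>The assumed lower bound 24 absorbs the rounding: from that size on, the
      integer fifth is at least a sixth.\<close>
    then have "card (W x) \<le> 6 * (card (W x) div 5)" by linarith
    then have "card (W x) \<le> 6 * card (A x i)" using pieces(2)[OF finW that(2)] by (simp add: A_def)
    then show "real (card (W x)) \<le> 6 * real (card (A x i))" by linarith
    then show "\<tau> * n / 6 \<le> real (card (A x i))" using b by simp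
  qed
  have block: "(\<Sum>u\<in>A x i. \<Sum>v\<in>A y j. 1 - h u v) \<le> real (card (A x i)) * real (card (A y j)) / 10"
    if "good x y" "x \<in> {x0, x1, x2, x3, x4}" "y \<in> {x0, x1, x2, x3, x4}" "i < 5" "j < 5" for x y i j
  proof -
    have h1: "0 \<le> 1 - h u v" for u v by (simp add: h_def)
    have "(\<Sum>u\<in>A x i. \<Sum>v\<in>A y j. 1 - h u v) \<le> (\<Sum>u\<in>A x i. \<Sum>v\<in>W y. 1 - h u v)"
      using AW[OF that(5)] finW h1 by (intro sum_mono sum_mono2) auto
    also have "\<dots> \<le> (\<Sum>u\<in>W x. \<Sum>v\<in>W y. 1 - h u v)"
      using AW[OF that(4)] finW h1 by (intro sum_mono2 sum_nonneg) auto
    also have "\<dots> = (\<Sum>u\<in>W x. \<Sum>v\<in>W y. if g u v < c / (2 * s) then 1 else 0)"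
      by (intro sum.cong refl) (simp add: h_def)
    also have "\<dots> \<le> real (card (W x)) * real (card (W y)) / 1000"
      using that(1) unfolding good_def W_def .
    also have "\<dots> \<le> (6 * real (card (A x i))) * (6 * real (card (A y j))) / 1000"
      using cA[OF that(2,4)] cA[OF that(3,5)] by (intro divide_right_mono mult_mono) auto
    \<comment> \<open>The threshold 1000 leaves room for the loss of 36 in passing to pieces, as
      \<open>36 / 1000\<close> is below \<open>1 / 10\<close>.\<close>
    also have "\<dots> \<le> real (card (A x i)) * real (card (A y j)) / 10" by simp
    finally show ?thesis .
  qed
  define A0 A1 A2 A3 A4 where "A0 = A x0 0" and "A1 = A x1 1" and "A2 = A x2 2"
    and "A3 = A x3 3" and "A4 = A x4 4"
  note A_defs = A0_def A1_def A2_def A3_def A4_def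
  have Asub: "A0 \<subseteq> V" "A1 \<subseteq> V" "A2 \<subseteq> V" "A3 \<subseteq> V" "A4 \<subseteq> V"
    unfolding A_defs by (rule AV; simp)+
  define H where "H = (\<Sum>x1\<in>A1. \<Sum>x2\<in>A2. \<Sum>x3\<in>A3. \<Sum>x4\<in>A4. \<Sum>x0\<in>A0.
    h x0 x1 * h x1 x2 * h x2 x3 * h x3 x4 * h x4 x0)"
  have "real (card A0) * card A1 * card A2 * card A3 * card A4 / 2 \<le> H"
    unfolding H_def
  proof (rule dense_C5_count)
    show "h x y = 0 \<or> h x y = 1" for x y by (simp add: h_def)
  qed (unfold A_defs of_nat_mult, (rule block; use good in simp)+)
  moreover have "(\<tau> * n / 6) * (\<tau> * n / 6) * (\<tau> * n / 6) * (\<tau> * n / 6) * (\<tau> * n / 6)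
      \<le> real (card A0) * card A1 * card A2 * card A3 * card A4"
  proof -
    have "0 \<le> \<tau> * n / 6" using \<tau> npos by simp
    moreover have "\<tau> * n / 6 \<le> card A0" "\<tau> * n / 6 \<le> card A1" "\<tau> * n / 6 \<le> card A2"
      "\<tau> * n / 6 \<le> card A3" "\<tau> * n / 6 \<le> card A4"
      unfolding A_defs by (rule cA(2); simp)+
    ultimately show ?thesis by (intro mult_mono mult_nonneg_nonneg) simp_all
  qed
  ultimately have H: "(\<tau> * n / 6)^5 / 2 \<le> H" by (simp add: numeral_eq_Suc)
  have degA: "(\<Sum>y\<in>B. f x y) \<le> M * s" if "x \<in> A'" "A' \<subseteq> V" "B \<subseteq> V" for x A' B
  proof -
    have "(\<Sum>y\<in>B. f x y) \<le> (\<Sum>y\<in>V. f x y)" using fin that f_nonneg by (intro sum_mono2) auto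
    then show ?thesis using deg[of x] that by force
  qed
  have "\<theta>^5 * H - (n * \<kappa> + \<theta> * (n * (\<delta> * n^2) + n * (M * s * \<kappa>) + \<theta> * (n^2 * \<kappa> + \<theta> * (n^2 * (\<delta> * n^2)
      + n^2 * (M * s * \<kappa>) + \<theta> * (n^3 * \<kappa>)))))
    \<le> (\<Sum>x3\<in>A3. \<Sum>x0\<in>A0. \<Sum>x1\<in>A1. f x0 x1 * (\<Sum>x2\<in>A2. f x1 x2 * f x2 x3)
      * (\<Sum>x4\<in>A4. f x3 x4 * f x4 x0))"
    unfolding H_def
  proof (rule C5_counting[OF fin n_def _ gh Asub f_nonneg])
    show "cut_lower V f g \<kappa>" using cut by (simp add: \<kappa>_def n_def)
    show "0 \<le> h x y" "h x y \<le> 1" for x y by (auto simp: h_def)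
    show "0 \<le> \<kappa>" using \<eta> npos spos by (simp add: \<kappa>_def)
    show "0 \<le> \<theta>" using \<theta> by simp
    show "0 \<le> M * s" using M spos by simp
    show "0 \<le> \<delta> * n^2" using \<delta> by simp
    show "(\<Sum>x3\<in>A3. f x2 x3) \<le> M * s" if "x2 \<in> A2" for x2 using degA[OF that] Asub by blast
    show "(\<Sum>x0\<in>A0. f x4 x0) \<le> M * s" if "x4 \<in> A4" for x4 using degA[OF that] Asub by blast
    have C4': "C4_sum \<le> \<delta> * n^2" using C4 by (simp add: n_def)
    have "A1 \<inter> A3 = {}" "A3 \<inter> A0 = {}" unfolding A_defs by (rule disj; simp)+
    then show "(\<Sum>x1\<in>A1. \<Sum>x3\<in>A3. (\<Sum>x2\<in>A2. f x1 x2 * f x2 x3) - min (\<Sum>x2\<in>A2. f x1 x2 * f x2 x3) 1) \<le> \<delta> * n^2"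
      and "(\<Sum>x3\<in>A3. \<Sum>x0\<in>A0. (\<Sum>x4\<in>A4. f x3 x4 * f x4 x0) - min (\<Sum>x4\<in>A4. f x3 x4 * f x4 x0) 1) \<le> \<delta> * n^2"
      using restricted_codeg_excess_sum[OF Asub(2,3,4)] restricted_codeg_excess_sum[OF Asub(4,5,1)] C4'
      by linarith+
  qed
  also have "\<dots> \<le> real (card (cycle_lists 5))"
    by (rule C5_sum_le_card[OF Asub]) (unfold A_defs, (rule disj; simp)+)
  finally have main: "\<theta>^5 * H - (n * \<kappa> + \<theta> * (n * (\<delta> * n^2) + n * (M * s * \<kappa>) + \<theta> * (n^2 * \<kappa> + \<theta> * (n^2 * (\<delta> * n^2)
      + n^2 * (M * s * \<kappa>) + \<theta> * (n^3 * \<kappa>))))) \<le> real (card (cycle_lists 5))" .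
  \<comment> \<open>Since \<open>n = s\<^sup>2\<close>, \<open>\<kappa> = \<eta> * s\<^sup>3\<close>
    and \<open>\<theta> = e / s\<close>, every error term has order \<open>s\<^sup>5\<close>, the
    same as the main term; only the coefficients have to be compared.\<close>
  have err: "n * \<kappa> + \<theta> * (n * (\<delta> * n^2) + n * (M * s * \<kappa>) + \<theta> * (n^2 * \<kappa> + \<theta> * (n^2 * (\<delta> * n^2)
      + n^2 * (M * s * \<kappa>) + \<theta> * (n^3 * \<kappa>))))
    = (\<eta> + e * \<delta> + e * (M * \<eta>) + e^2 * \<eta> + e^3 * \<delta> + e^3 * (M * \<eta>) + e^4 * \<eta>) * s^5"
    unfolding \<kappa>_def \<theta>_def ns using spos by (simp add: field_simps numeral_eq_Suc)
  have "\<eta> + e * \<delta> + e * (M * \<eta>) + e^2 * \<eta> + e^3 * \<delta> + e^3 * (M * \<eta>) + e^4 * \<eta>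
    \<le> M * \<eta> + 1 * \<delta> + 1 * (M * \<eta>) + M * \<eta> + 1 * \<delta> + 1 * (M * \<eta>) + M * \<eta>"
  proof -
    have pw: "e^k \<le> 1" for k using epos by (simp add: power_le_one)
    have pwM: "e^k \<le> M" for k using pw[of k] M by linarith
    have "1 * \<eta> \<le> M * \<eta>" using M \<eta> by (intro mult_right_mono)
    then show ?thesis
      using pwM[of 2] pwM[of 4] pw[of 3] M \<eta> \<delta> epos
      by (intro add_mono mult_right_mono) simp_all
  qed
  then have "(\<eta> + e * \<delta> + e * (M * \<eta>) + e^2 * \<eta> + e^3 * \<delta> + e^3 * (M * \<eta>) + e^4 * \<eta>) * s^5
      \<le> (5 * M * \<eta> + 2 * \<delta>) * s^5"
    using spos by (intro mult_right_mono) auto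
  moreover have "(c * \<tau> / 12)^5 / 2 * s^5 \<le> \<theta>^5 * H"
  proof -
    have "(c * \<tau> / 12)^5 / 2 * s^5 = \<theta>^5 * ((\<tau> * n / 6)^5 / 2)"
      unfolding \<theta>_def e_def ns using spos by (simp add: field_simps numeral_eq_Suc)
    also have "\<dots> \<le> \<theta>^5 * H" using H \<theta> by (intro mult_left_mono) auto
    finally show ?thesis .
  qed
  ultimately show ?thesis using main unfolding err left_diff_distrib distrib_right by linarith
qed

section \<open>Edges lost to small, sparse and irregular blocks\<close>

lemma small_atom_edges:
  assumes P: "finite \<P>" "card \<P> \<le> m" and t: "0 \<le> t" and d: "0 \<le> d"
    and deg: "\<And>x. x \<in> V \<Longrightarrow> (\<Sum>y\<in>V. f x y) \<le> d"
  shows "(\<Sum>x\<in>V. \<Sum>y\<in>V. if real (card (atom V \<P> x)) < t then f x y else 0) \<le> 2 ^ m * t * d"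
proof -
  let ?U = "{x\<in>V. real (card (atom V \<P> x)) < t}"
  have "(\<Sum>x\<in>V. \<Sum>y\<in>V. if real (card (atom V \<P> x)) < t then f x y else 0)
      = (\<Sum>x\<in>V. if real (card (atom V \<P> x)) < t then (\<Sum>y\<in>V. f x y) else 0)"
    by (intro sum.cong refl) simp
  also have "\<dots> = (\<Sum>x\<in>?U. \<Sum>y\<in>V. f x y)"
    using fin by (simp only: sum.inter_filter)
  also have "\<dots> \<le> (\<Sum>x\<in>?U. d)" by (intro sum_mono deg) simp
  also have "\<dots> = real (card ?U) * d" by simp
  also have "\<dots> \<le> (2 ^ card \<P> * t) * d"
    using card_small_atoms[OF fin P(1) t] d by (intro mult_right_mono)
  also have "\<dots> \<le> (2 ^ m * t) * d"
    using P(2) t d by (intro mult_right_mono power_increasing) auto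
  finally show ?thesis .
qed

text \<open>The set of sparse pairs is a union of blocks, so \<open>f\<close> may be replaced there
  by its block average, which is below \<open>b\<close>.\<close>

lemma sparse_block_edges:
  assumes b: "0 \<le> b"
  shows "(\<Sum>x\<in>V. \<Sum>y\<in>V. if avg V \<P> f x y < b then f x y else 0) \<le> b * (real (card V))\<^sup>2"
proof -
  define i where "i = (\<lambda>x y. if avg V \<P> f x y < b then 1 else (0::real))"
  have bw: "blockwise V \<P> i"
    unfolding i_def by (rule blockwise_compose[OF blockwise_avg])
  have "(\<Sum>x\<in>V. \<Sum>y\<in>V. if avg V \<P> f x y < b then f x y else 0) = (\<Sum>x\<in>V. \<Sum>y\<in>V. f x y * i x y)"
    by (intro sum.cong refl) (simp add: i_def)
  also have "\<dots> = (\<Sum>x\<in>V. \<Sum>y\<in>V. avg V \<P> f x y * i x y)"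
    by (rule sum_avg_mult[OF fin bw, symmetric])
  also have "\<dots> \<le> (\<Sum>x\<in>V. \<Sum>y\<in>V. b)"
    using b by (intro sum_mono) (simp add: i_def)
  also have "\<dots> = b * (real (card V))\<^sup>2" by (simp add: power2_eq_square)
  finally show ?thesis .
qed

text \<open>On a blockwise set of pairs, \<^term>\<open>f\<close> may be replaced by its average in the first variable, and the
  scarcity of 4-cycles bounds this average in \<open>L\<^sup>2\<close>.\<close>

lemma blockwise_edges_le:
  fixes d a :: real
  assumes bw: "blockwise V \<P> B" and d: "0 \<le> d"
    and deg: "\<And>x. x \<in> V \<Longrightarrow> (\<Sum>y\<in>V. f x y) \<le> d"
    and big: "\<And>x y. x \<in> V \<Longrightarrow> y \<in> V \<Longrightarrow> B x y \<Longrightarrow> 2 * d \<le> card (atom V \<P> x) \<and>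
      2 * C4_sum \<le> (real (card (atom V \<P> x)))\<^sup>2"
    and a: "0 < a"
  shows "(\<Sum>x\<in>V. \<Sum>y\<in>V. if B x y then f x y else 0)
    \<le> a * card V + (\<Sum>x\<in>V. \<Sum>y\<in>V. if B x y then 1 else 0) / (2 * a)"
proof -
  define i where "i = (\<lambda>x y. if B x y then 1 else (0::real))"
  define r where "r = (\<lambda>x y. avg1 V \<P> (\<lambda>u. f u y) x)"
  have i_const: "i u y = i x y" if "y \<in> V" "x \<in> V" "u \<in> atom V \<P> x" for x y u
    using bw that atom_self[OF that(1), of \<P>] unfolding blockwise_def i_def by metis
  have "(\<Sum>x\<in>V. \<Sum>y\<in>V. if B x y then f x y else 0) = (\<Sum>x\<in>V. \<Sum>y\<in>V. f x y * i x y)"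
    by (intro sum.cong refl) (simp add: i_def)
  also have "\<dots> = (\<Sum>y\<in>V. \<Sum>x\<in>V. f x y * i x y)" by (rule sum.swap)
  also have "\<dots> = (\<Sum>y\<in>V. \<Sum>x\<in>V. r x y * i x y)"
    unfolding r_def by (intro sum.cong refl sum_avg1_mult[symmetric] fin i_const)
  also have "\<dots> = (\<Sum>x\<in>V. \<Sum>y\<in>V. r x y * i x y)" by (rule sum.swap)
  also have "\<dots> \<le> (\<Sum>x\<in>V. a + (\<Sum>y\<in>V. i x y) / (2 * a))"
  proof (rule sum_mono)
    fix x assume x: "x \<in> V"
    show "(\<Sum>y\<in>V. r x y * i x y) \<le> a + (\<Sum>y\<in>V. i x y) / (2 * a)"
    proof (cases "\<exists>y\<in>V. B x y")
      case False
      then show ?thesis using a by (simp add: i_def)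
    next
      case True
      define W where "W = atom V \<P> x"
      have W: "2 * d \<le> card W" "2 * C4_sum \<le> (real (card W))\<^sup>2"
        using True big x by (auto simp: W_def)
      have Wpos: "0 < real (card W)" unfolding W_def using card_atom_pos[OF fin x] by simp
      have WV: "W \<subseteq> V" unfolding W_def by (rule atom_subset)
      have "(\<Sum>x\<in>W. \<Sum>y\<in>V. f x y) \<le> (\<Sum>x\<in>W. d)"
        using deg WV by (intro sum_mono) auto
      also have "\<dots> = real (card W) * d" by simp
      also have "2 * \<dots> \<le> (real (card W))\<^sup>2"
        using mult_left_mono[OF W(1), of "real (card W)"] by (simp add: power2_eq_square)
      finally have "2 * (\<Sum>x\<in>W. \<Sum>y\<in>V. f x y) \<le> (real (card W))\<^sup>2" by simp
      \<comment> \<open>The size assumptions make both the 4-cycle term and the edge term of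
        \<open>sum_degree_square\<close> at most half of the leading square.\<close>
      then have sq: "(\<Sum>y\<in>V. (\<Sum>u\<in>W. f u y)\<^sup>2) \<le> 2 * (real (card W))\<^sup>2"
        using sum_degree_square[OF WV] W(2) by linarith
      have "(\<Sum>y\<in>V. (r x y)\<^sup>2) = (\<Sum>y\<in>V. (\<Sum>u\<in>W. f u y)\<^sup>2) / (real (card W))\<^sup>2"
        unfolding sum_divide_distrib by (simp add: r_def avg1_def W_def power_divide)
      also have "\<dots> \<le> 2" using sq Wpos by (simp add: divide_le_eq)
      finally have r2: "(\<Sum>y\<in>V. (r x y)\<^sup>2) \<le> 2" .
      have "(\<Sum>y\<in>V. r x y * i x y) \<le> (\<Sum>y\<in>V. a / 2 * (r x y)\<^sup>2 + i x y / (2 * a))"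
      proof (rule sum_mono)
        fix y
        \<comment> \<open>The arithmetic-geometric mean inequality, weighted by \<open>a\<close>, in
          place of Cauchy-Schwarz.\<close>
        have "0 \<le> (a * r x y - 1)\<^sup>2 / (2 * a)" using a by simp
        also have "\<dots> = a / 2 * (r x y)\<^sup>2 + 1 / (2 * a) - r x y"
          using a by (simp add: power2_eq_square field_simps)
        finally show "r x y * i x y \<le> a / 2 * (r x y)\<^sup>2 + i x y / (2 * a)"
          using a by (simp add: i_def)
      qed
      also have "\<dots> = a / 2 * (\<Sum>y\<in>V. (r x y)\<^sup>2) + (\<Sum>y\<in>V. i x y) / (2 * a)"
        by (simp add: sum.distrib sum_distrib_left sum_divide_distrib)
      also have "\<dots> \<le> a / 2 * 2 + (\<Sum>y\<in>V. i x y) / (2 * a)"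
        using r2 a by (intro add_right_mono mult_left_mono) auto
      finally show ?thesis by simp
    qed
  qed
  also have "\<dots> = a * card V + (\<Sum>x\<in>V. \<Sum>y\<in>V. i x y) / (2 * a)"
    by (simp add: sum.distrib sum_divide_distrib)
  finally show ?thesis unfolding i_def .
qed

text \<open>On such a block the truncated average over \<open>\<P>\<close> equals \<open>b\<close>,
  while the one over \<open>\<Q>\<close> is below \<open>b / 2\<close> on a proportion of at least
  \<open>\<rho>\<close>. Each such pair costs \<open>b\<^sup>2 / 4\<close> of the squared
  distance.\<close>

lemma irregular_pairs_le:
  fixes b \<rho> \<alpha> :: real and \<P> \<Q> :: "'a set set"
  defines "w \<equiv> (\<lambda>u v. if trunc V \<Q> f b u v < b / 2 then 1 else (0::real))"
  assumes b: "0 < b" and \<rho>: "0 < \<rho>"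
    and bw: "blockwise V \<P> B"
    and B: "\<And>x y. x \<in> V \<Longrightarrow> y \<in> V \<Longrightarrow> B x y \<Longrightarrow> b \<le> avg V \<P> f x y \<and> \<rho> \<le> avg V \<P> w x y"
    and close: "(\<Sum>x\<in>V. \<Sum>y\<in>V. (trunc V \<P> f b x y - trunc V \<Q> f b x y)\<^sup>2) \<le> \<alpha>"
  shows "(\<Sum>x\<in>V. \<Sum>y\<in>V. if B x y then 1 else 0) \<le> 4 * \<alpha> / (\<rho> * b\<^sup>2)"
proof -
  define i where "i = (\<lambda>x y. if B x y then 1 else (0::real))"
  have bwi: "blockwise V \<P> i" unfolding i_def by (rule blockwise_compose[OF bw])
  have "\<rho> * (\<Sum>x\<in>V. \<Sum>y\<in>V. i x y) \<le> (\<Sum>x\<in>V. \<Sum>y\<in>V. avg V \<P> w x y * i x y)"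
    unfolding sum_distrib_left by (intro sum_mono) (use B in \<open>auto simp: i_def\<close>)
  also have "\<dots> = (\<Sum>x\<in>V. \<Sum>y\<in>V. w x y * i x y)" by (rule sum_avg_mult[OF fin bwi])
  also have "\<dots> \<le> (\<Sum>x\<in>V. \<Sum>y\<in>V. 4 / b\<^sup>2 * (trunc V \<P> f b x y - trunc V \<Q> f b x y)\<^sup>2)"
  proof (intro sum_mono)
    fix x y assume xy: "x \<in> V" "y \<in> V"
    show "w x y * i x y \<le> 4 / b\<^sup>2 * (trunc V \<P> f b x y - trunc V \<Q> f b x y)\<^sup>2"
    proof (cases "B x y \<and> trunc V \<Q> f b x y < b / 2")
      case True
      then have "trunc V \<P> f b x y = b" using B[OF xy] by (simp add: trunc_def)
      then have "b / 2 \<le> trunc V \<P> f b x y - trunc V \<Q> f b x y" using True by simp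
      then have "(b / 2)\<^sup>2 \<le> (trunc V \<P> f b x y - trunc V \<Q> f b x y)\<^sup>2"
        using b by (intro power_mono) auto
      then have "4 / b\<^sup>2 * (b / 2)\<^sup>2 \<le> 4 / b\<^sup>2 * (trunc V \<P> f b x y - trunc V \<Q> f b x y)\<^sup>2"
        by (intro mult_left_mono) auto
      moreover have "4 / b\<^sup>2 * (b / 2)\<^sup>2 = 1" using b by (simp add: power_divide)
      ultimately show ?thesis using True by (simp add: w_def i_def)
    next
      case False
      then show ?thesis by (auto simp: w_def i_def)
    qed
  qed
  also have "\<dots> = 4 / b\<^sup>2 * (\<Sum>x\<in>V. \<Sum>y\<in>V. (trunc V \<P> f b x y - trunc V \<Q> f b x y)\<^sup>2)"
    by (simp add: sum_distrib_left)
  also have "\<dots> \<le> 4 / b\<^sup>2 * \<alpha>" using close by (intro mult_left_mono) auto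
  finally have "\<rho> * (\<Sum>x\<in>V. \<Sum>y\<in>V. i x y) \<le> 4 / b\<^sup>2 * \<alpha>" .
  then have "(\<Sum>x\<in>V. \<Sum>y\<in>V. i x y) \<le> 4 / b\<^sup>2 * \<alpha> / \<rho>"
    by (subst pos_le_divide_eq[OF \<rho>]) (simp only: mult.commute[of \<rho>])
  also have "\<dots> = 4 * \<alpha> / (\<rho> * b\<^sup>2)" by (simp add: mult.commute)
  finally show ?thesis unfolding i_def .
qed

end

text \<open>\<open>B\<close> marks the pairs to be discarded. A closed walk of five steps avoiding
  \<open>B\<close> would run through good blocks only and force more 5-cycles than assumed.\<close>

lemma bounded_degree_hitting_set:
  fixes \<epsilon> M :: real
  assumes \<epsilon>: "0 < \<epsilon>" and M: "1 \<le> M"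
  shows "\<exists>n0 \<delta>. 0 < \<delta> \<and> (\<forall>(V::'a set) f. fin_graph V f \<longrightarrow> n0 \<le> card V \<longrightarrow>
    (\<forall>x\<in>V. (\<Sum>y\<in>V. f x y) \<le> M * sqrt (card V)) \<longrightarrow>
    fin_graph.C4_sum V f \<le> \<delta> * (real (card V))\<^sup>2 \<longrightarrow>
    real (card (fin_graph.cycle_lists V f 5)) \<le> \<delta> * sqrt (card V) ^ 5 \<longrightarrow>
    (\<exists>B. (\<Sum>x\<in>V. \<Sum>y\<in>V. if B x y then f x y else 0) \<le> \<epsilon> * card V * sqrt (card V) \<and>
      (\<forall>x0\<in>V. \<forall>x1\<in>V. \<forall>x2\<in>V. \<forall>x3\<in>V. \<forall>x4\<in>V. B x0 x1 \<or> B x1 x2 \<or> B x2 x3 \<or> B x3 x4 \<or> B x4 x0)))"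
proof -
  \<comment> \<open>Sparse blocks may lose \<open>\<epsilon> / 4\<close>, which fixes
    \<open>c\<close>; small atoms lose the same, which fixes \<open>\<tau>\<close>; irregular blocks
    may lose \<open>\<epsilon> / 2\<close>, which fixes \<open>\<alpha>\<close>. \<open>C\<close> is
    the main coefficient of the 5-cycle count, and \<open>\<eta>\<close> makes the cut error a
    quarter of it.\<close>
  define c where "c = min (\<epsilon> / 4) 1"
  define \<alpha> where "\<alpha> = \<epsilon>\<^sup>2 * c\<^sup>2 / 32000"
  define \<tau> where "\<tau> = (\<lambda>m::nat. \<epsilon> / (4 * M * 2 ^ m))"
  define C where "C = (\<lambda>m. (c * \<tau> m / 12) ^ 5 / 2)"
  define \<eta> where "\<eta> = (\<lambda>m. C m / (20 * M))"
  have c: "0 < c" "c \<le> 1" "c \<le> \<epsilon> / 4" using \<epsilon> by (auto simp: c_def)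
  have \<alpha>: "0 < \<alpha>" using \<epsilon> c by (simp add: \<alpha>_def)
  have \<tau>: "0 < \<tau> m" for m using \<epsilon> M by (simp add: \<tau>_def)
  have C: "0 < C m" for m using \<tau> c by (simp add: C_def)
  have \<eta>: "0 < \<eta> m" for m using C M by (simp add: \<eta>_def)
  obtain N where N: "\<forall>(V::'a set) f. finite V \<longrightarrow> V \<noteq> {} \<longrightarrow> (\<forall>x y. 0 \<le> f x y) \<longrightarrow>
      (\<Sum>x\<in>V. \<Sum>y\<in>V. f x y) \<le> M * card V * sqrt (card V) \<longrightarrow>
      (\<exists>\<P> \<Q> m. finite \<P> \<and> card \<P> \<le> m \<and> m \<le> N \<and>
        regular_pair V f (c / sqrt (card V)) (\<eta> m * card V * sqrt (card V)) (\<alpha> * card V) \<P> \<Q>)"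
    using strong_regularity[OF \<alpha> \<eta> less_imp_le[OF c(1)], where 'a = 'a and M = M] ..
  \<comment> \<open>The complexity \<open>m\<close> varies with the graph, so
    \<open>\<delta>\<close> and \<open>n0\<close> use its uniform bound \<open>N\<close>; both
    \<open>\<tau>\<close> and \<open>C\<close> decrease in \<open>m\<close>. The second entry of the
    minimum keeps \<open>2 * C4_sum\<close> below the square of every atom that is not
    small.\<close>
  define \<delta> where "\<delta> = min (C N / 16) ((\<tau> N)\<^sup>2 / 2)"
  \<comment> \<open>The summands ensure that non-small atoms have at least 24 vertices and at least
    twice the maximal degree.\<close>
  define n0 where "n0 = nat \<lceil>24 / \<tau> N + (2 * M / \<tau> N)\<^sup>2\<rceil> + 1"
  have \<delta>: "0 < \<delta>" using C[of N] \<tau>[of N] by (simp add: \<delta>_def)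
  show ?thesis
  proof (intro exI[of _ n0] exI[of _ \<delta>] conjI allI impI \<delta>)
    fix V :: "'a set" and f
    assume "fin_graph V f"
    then interpret fin_graph V f .
    define n where "n = real (card V)"
    define s where "s = sqrt n"
    assume n0: "n0 \<le> card V" and deg': "\<forall>x\<in>V. (\<Sum>y\<in>V. f x y) \<le> M * sqrt (card V)"
      and C4': "C4_sum \<le> \<delta> * (real (card V))\<^sup>2"
      and C5': "real (card (cycle_lists 5)) \<le> \<delta> * sqrt (card V) ^ 5"
    have deg: "(\<Sum>y\<in>V. f x y) \<le> M * s" if "x \<in> V" for x
      using deg' that by (simp add: s_def n_def)
    have C4: "C4_sum \<le> \<delta> * n\<^sup>2" and C5: "real (card (cycle_lists 5)) \<le> \<delta> * s ^ 5"
      using C4' C5' by (simp_all add: s_def n_def)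
    have "24 / \<tau> N + (2 * M / \<tau> N)\<^sup>2 \<le> real n0"
      unfolding n0_def using real_nat_ceiling_ge[of "24 / \<tau> N + (2 * M / \<tau> N)\<^sup>2"] by linarith
    also have "\<dots> \<le> n" using n0 by (simp add: n_def)
    finally have nb: "24 / \<tau> N + (2 * M / \<tau> N)\<^sup>2 \<le> n" .
    have "24 / \<tau> N \<le> n" using nb zero_le_power2[of "2 * M / \<tau> N"] by linarith
    then have n24: "24 \<le> \<tau> N * n" using \<tau>[of N] by (simp add: field_simps)
    have npos: "0 < n" using n0 by (simp add: n_def n0_def)
    have spos: "0 < s" using npos by (simp add: s_def)
    have ss: "s * s = n" using npos by (simp add: s_def)
    have "0 \<le> 24 / \<tau> N" using \<tau>[of N] by simp
    then have "(2 * M / \<tau> N)\<^sup>2 \<le> n" using nb by linarith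
    then have "2 * M / \<tau> N \<le> s" unfolding s_def by (rule real_le_rsqrt)
    then have "2 * M \<le> \<tau> N * s" using \<tau>[of N] by (simp add: field_simps)
    then have "2 * M * s \<le> \<tau> N * s * s" using spos by (intro mult_right_mono) auto
    then have nM: "2 * (M * s) \<le> \<tau> N * n" using ss by (simp add: mult.assoc)
    have "V \<noteq> {}" using npos by (auto simp: n_def)
    have "(\<Sum>x\<in>V. \<Sum>y\<in>V. f x y) \<le> (\<Sum>x\<in>V. M * s)" by (intro sum_mono deg)
    also have "\<dots> = M * card V * sqrt (card V)" by (simp add: s_def n_def)
    finally obtain \<P> \<Q> m where P: "finite \<P>" "card \<P> \<le> m" "m \<le> N" and
      reg: "regular_pair V f (c / s) (\<eta> m * n * s) (\<alpha> * n) \<P> \<Q>"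
      using N[rule_format, OF fin \<open>V \<noteq> {}\<close>, of f] f_nonneg unfolding s_def n_def by blast
    have \<tau>m: "\<tau> N \<le> \<tau> m"
      unfolding \<tau>_def using \<epsilon> M P(3) by (intro divide_left_mono mult_left_mono power_increasing) auto
    have Cm: "C N \<le> C m"
      unfolding C_def using \<tau>m \<tau> c by (intro divide_right_mono power_mono mult_left_mono) (auto intro: less_imp_le)
    define t where "t = \<tau> m * n"
    have "\<tau> N * n \<le> t" unfolding t_def using \<tau>m npos by (intro mult_right_mono) auto
    then have t: "24 \<le> t" "2 * (M * s) \<le> t" "\<tau> N * n \<le> t"
      using n24 nM by linarith+
    define w where "w = (\<lambda>u v. if trunc V \<Q> f (c / s) u v < c / s / 2 then 1 else (0::real))"
    define B3 where "B3 = (\<lambda>x y. t \<le> card (atom V \<P> x) \<and> c / s \<le> avg V \<P> f x y \<and> 1 / 1000 \<le> avg V \<P> w x y)"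
    \<comment> \<open>Only the atom of the first vertex is tested for size: along a closed walk
      every vertex comes first in some pair.\<close>
    define B where "B = (\<lambda>x y. real (card (atom V \<P> x)) < t \<or> avg V \<P> f x y < c / s \<or> B3 x y)"
    have bs: "0 < c / s" using c spos by simp
    have bw: "blockwise V \<P> B3" unfolding blockwise_def B3_def avg_eq by (auto simp: atom_eq)
    have e1: "(\<Sum>x\<in>V. \<Sum>y\<in>V. if real (card (atom V \<P> x)) < t then f x y else 0) \<le> \<epsilon> / 4 * (n * s)"
    proof -
      have "(\<Sum>x\<in>V. \<Sum>y\<in>V. if real (card (atom V \<P> x)) < t then f x y else 0) \<le> 2 ^ m * t * (M * s)"
        using t M spos by (intro small_atom_edges P deg) auto
      also have "\<dots> = \<epsilon> / 4 * (n * s)" using M by (simp add: t_def \<tau>_def)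
      finally show ?thesis .
    qed
    have e2: "(\<Sum>x\<in>V. \<Sum>y\<in>V. if avg V \<P> f x y < c / s then f x y else 0) \<le> \<epsilon> / 4 * (n * s)"
    proof -
      have "(\<Sum>x\<in>V. \<Sum>y\<in>V. if avg V \<P> f x y < c / s then f x y else 0) \<le> c / s * n\<^sup>2"
        unfolding n_def using bs by (intro sparse_block_edges) auto
      also have "\<dots> = c * (n * s)" unfolding ss[symmetric] using spos by (simp add: power2_eq_square)
      also have "\<dots> \<le> \<epsilon> / 4 * (n * s)" using c npos spos by (intro mult_right_mono) auto
      finally show ?thesis .
    qed
    have e3: "(\<Sum>x\<in>V. \<Sum>y\<in>V. if B3 x y then f x y else 0) \<le> \<epsilon> / 2 * (n * s)"
    proof -
      have cnt: "(\<Sum>x\<in>V. \<Sum>y\<in>V. if B3 x y then 1 else 0) \<le> 4 * (\<alpha> * n) / (1 / 1000 * (c / s)\<^sup>2)"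
      proof (rule irregular_pairs_le[OF bs _ bw])
        show "(\<Sum>x\<in>V. \<Sum>y\<in>V. (trunc V \<P> f (c / s) x y - trunc V \<Q> f (c / s) x y)\<^sup>2) \<le> \<alpha> * n"
          using reg by (simp add: regular_pair_def)
      qed (auto simp: B3_def w_def)
      \<comment> \<open>The free parameter of \<open>blockwise_edges_le\<close> is taken as
        \<open>\<epsilon> / 4 * s\<close>, half of the allowance; the value of
        \<open>\<alpha>\<close> makes the second summand the other half.\<close>
      have "(\<Sum>x\<in>V. \<Sum>y\<in>V. if B3 x y then f x y else 0)
          \<le> \<epsilon> / 4 * s * card V + (\<Sum>x\<in>V. \<Sum>y\<in>V. if B3 x y then 1 else 0) / (2 * (\<epsilon> / 4 * s))"
      proof (rule blockwise_edges_le[OF bw _ deg])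
        show "0 \<le> M * s" "0 < \<epsilon> / 4 * s" using M spos \<epsilon> by auto
        fix x y assume "B3 x y"
        then have tc: "t \<le> card (atom V \<P> x)" by (simp add: B3_def)
        have "2 * C4_sum \<le> 2 * (\<delta> * n\<^sup>2)" using C4 by simp
        also have "\<dots> \<le> 2 * ((\<tau> N)\<^sup>2 / 2 * n\<^sup>2)"
          by (intro mult_left_mono mult_right_mono) (auto simp: \<delta>_def)
        also have "\<dots> = (\<tau> N * n)\<^sup>2" by (simp add: power_mult_distrib)
        also have "\<dots> \<le> (real (card (atom V \<P> x)))\<^sup>2"
          using tc t n24 by (intro power_mono) auto
        finally show "2 * (M * s) \<le> card (atom V \<P> x) \<and> 2 * C4_sum \<le> (real (card (atom V \<P> x)))\<^sup>2"
          using tc t by simp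
      qed
      also have "\<dots> \<le> \<epsilon> / 4 * s * n + (4 * (\<alpha> * n) / (1 / 1000 * (c / s)\<^sup>2)) / (2 * (\<epsilon> / 4 * s))"
        unfolding n_def[symmetric] using cnt \<epsilon> spos by (intro add_left_mono divide_right_mono) auto
      also have "\<dots> = \<epsilon> / 2 * (n * s)"
        unfolding \<alpha>_def using c \<epsilon> spos by (simp add: power2_eq_square field_simps)
      finally show ?thesis .
    qed
    have "(\<Sum>x\<in>V. \<Sum>y\<in>V. if B x y then f x y else 0)
        \<le> (\<Sum>x\<in>V. \<Sum>y\<in>V. (if real (card (atom V \<P> x)) < t then f x y else 0)
          + (if avg V \<P> f x y < c / s then f x y else 0) + (if B3 x y then f x y else 0))"
      using f_nonneg by (intro sum_mono) (simp add: B_def)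
    also have "\<dots> \<le> \<epsilon> * n * s"
      using e1 e2 e3 by (simp add: sum.distrib)
    finally have total: "(\<Sum>x\<in>V. \<Sum>y\<in>V. if B x y then f x y else 0) \<le> \<epsilon> * n * s" .
    have "B x0 x1 \<or> B x1 x2 \<or> B x2 x3 \<or> B x3 x4 \<or> B x4 x0"
      if x: "x0 \<in> V" "x1 \<in> V" "x2 \<in> V" "x3 \<in> V" "x4 \<in> V" for x0 x1 x2 x3 x4
    proof (rule ccontr)
      assume "\<not> (B x0 x1 \<or> B x1 x2 \<or> B x2 x3 \<or> B x3 x4 \<or> B x4 x0)"
      then have nB: "\<not> B x0 x1" "\<not> B x1 x2" "\<not> B x2 x3" "\<not> B x3 x4" "\<not> B x4 x0" by auto
      have gd: "(\<Sum>u\<in>atom V \<P> x. \<Sum>v\<in>atom V \<P> y. if trunc V \<Q> f (c / s) u v < c / (2 * s) then 1 else 0)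
          \<le> real (card (atom V \<P> x)) * real (card (atom V \<P> y)) / 1000"
        if "\<not> B x y" "x \<in> V" "y \<in> V" for x y
      proof -
        have "avg V \<P> w x y < 1 / 1000" using that(1) by (auto simp: B_def B3_def)
        moreover have "0 < real (card (atom V \<P> x)) * real (card (atom V \<P> y))"
          using card_atom_pos[OF fin] that(2,3) by simp
        ultimately show ?thesis unfolding avg_eq w_def by (simp add: pos_divide_less_eq mult.commute)
      qed
      have "((c * \<tau> m / 12)^5 / 2 - 5 * M * \<eta> m - 2 * \<delta>) * s ^ 5 \<le> real (card (cycle_lists 5))"
      proof (rule many_C5_of_good_blocks[where \<P> = \<P> and \<Q> = \<Q>, OF c(1,2) M less_imp_le[OF \<eta>] less_imp_le[OF \<delta>] _ _ _ \<tau> _ x,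
            folded n_def, folded s_def])
        show "cut_lower V f (trunc V \<Q> f (c / s)) (\<eta> m * n * s)" using reg by (simp add: regular_pair_def)
        show "24 \<le> \<tau> m * n" using t by (simp add: t_def)
        show "\<tau> m * n \<le> card (atom V \<P> x)" if "x \<in> {x0, x1, x2, x3, x4}" for x
          using that nB by (auto simp: B_def t_def)
      qed (use deg C4 gd nB x in auto)
      then have "(C m - 5 * M * \<eta> m - 2 * \<delta>) * s ^ 5 \<le> \<delta> * s ^ 5"
        using C5 by (simp add: C_def)
      \<comment> \<open>The next two facts turn this into
        \<open>3 / 4 * C m \<le> 3 / 16 * C m\<close>, impossible for positive
        \<open>C m\<close>.\<close>
      then have "C m - 5 * M * \<eta> m - 2 * \<delta> \<le> \<delta>" using spos by simp
      moreover have "5 * M * \<eta> m = C m / 4" using M by (simp add: \<eta>_def)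
      moreover have "\<delta> \<le> C m / 16" using Cm by (simp add: \<delta>_def)
      ultimately show False using C[of m] by simp
    qed
    then show "\<exists>B. (\<Sum>x\<in>V. \<Sum>y\<in>V. if B x y then f x y else 0) \<le> \<epsilon> * card V * sqrt (card V) \<and>
      (\<forall>x0\<in>V. \<forall>x1\<in>V. \<forall>x2\<in>V. \<forall>x3\<in>V. \<forall>x4\<in>V. B x0 x1 \<or> B x1 x2 \<or> B x2 x3 \<or> B x3 x4 \<or> B x4 x0)"
      using total unfolding n_def s_def by blast
  qed
qed

section \<open>The removal lemma\<close>

text \<open>Recovers the vertex set from the edge set, so lists with the same cycle edges have the
  same entries.\<close>

lemma Union_cycle_edges: "\<Union> (cycle_edges xs) = set xs"
proof
  show "\<Union> (cycle_edges xs) \<subseteq> set xs"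
    by (auto simp: cycle_edges_def intro!: nth_mem mod_less_divisor)
  show "set xs \<subseteq> \<Union> (cycle_edges xs)"
  proof
    fix x assume "x \<in> set xs"
    then obtain i where i: "i < length xs" "xs ! i = x" by (auto simp: in_set_conv_nth)
    then have "{xs ! i, xs ! ((i + 1) mod length xs)} \<in> cycle_edges xs"
      unfolding cycle_edges_def by blast
    then show "x \<in> \<Union> (cycle_edges xs)" using i(2) by blast
  qed
qed

text \<open>All lists tracing one copy are words of length \<open>k\<close> over its
  \<open>k\<close> vertices; the crude bound \<open>k ^ k\<close> suffices, since only a constant
  factor matters.\<close>

lemma card_cycle_edge_lists_le:
  assumes E: "finite E"
  shows "card {xs. length xs = k \<and> distinct xs \<and> cycle_edges xs \<subseteq> E} \<le> k ^ k * num_cycle_copies k E"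
proof -
  let ?fib = "\<lambda>C. {xs. length xs = k \<and> distinct xs \<and> cycle_edges xs = C}"
  have "finite (cycle_copies k E)"
    by (rule finite_subset[of _ "Pow E"]) (auto simp: cycle_copies_def E)
  moreover have "{xs. length xs = k \<and> distinct xs \<and> cycle_edges xs \<subseteq> E} = (\<Union>C\<in>cycle_copies k E. ?fib C)"
    unfolding cycle_copies_def by blast
  ultimately have "card {xs. length xs = k \<and> distinct xs \<and> cycle_edges xs \<subseteq> E}
      \<le> (\<Sum>C\<in>cycle_copies k E. card (?fib C))"
    using card_UN_le by fastforce
  also have "\<dots> \<le> (\<Sum>C\<in>cycle_copies k E. k ^ k)"
  proof (rule sum_mono)
    fix C assume "C \<in> cycle_copies k E"
    then obtain xs where xs: "length xs = k" "distinct xs" "C = cycle_edges xs"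
      by (auto simp: cycle_copies_def)
    have "?fib C \<subseteq> {ys. set ys \<subseteq> set xs \<and> length ys = k}"
    proof
      fix ys assume "ys \<in> ?fib C"
      then have ys: "length ys = k" "cycle_edges ys = cycle_edges xs" by (auto simp: xs(3))
      have "set ys = set xs"
        using Union_cycle_edges[of ys] Union_cycle_edges[of xs] unfolding ys(2) by simp
      then show "ys \<in> {ys. set ys \<subseteq> set xs \<and> length ys = k}" using ys by simp
    qed
    then have "card (?fib C) \<le> card {ys. set ys \<subseteq> set xs \<and> length ys = k}"
      by (intro card_mono finite_lists_length_eq) auto
    also have "\<dots> = k ^ k"
      using xs by (simp add: card_lists_length_eq distinct_card)
    finally show "card (?fib C) \<le> k ^ k" .
  qed
  finally show ?thesis by (simp add: num_cycle_copies_def mult.commute)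
qed

lemma powr_three_halves: "0 \<le> x \<Longrightarrow> x powr (3 / 2) = x * sqrt x"
proof -
  assume "0 \<le> x"
  have "x powr (1 + 1 / 2) = x powr 1 * x powr (1 / 2)" by (rule powr_add)
  then show ?thesis using \<open>0 \<le> x\<close> by (simp add: powr_half_sqrt)
qed

lemma powr_five_halves: "0 \<le> x \<Longrightarrow> x powr (5 / 2) = sqrt x ^ 5"
proof -
  assume x: "0 \<le> x"
  have "x powr (1 + 3 / 2) = x powr 1 * x powr (3 / 2)" by (rule powr_add)
  then have "x powr (5 / 2) = x * (x * sqrt x)" using x by (simp add: powr_three_halves)
  also have "\<dots> = (sqrt x * sqrt x) * ((sqrt x * sqrt x) * sqrt x)" using x by simp
  finally show ?thesis by (simp add: numeral_eq_Suc)
qed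

theorem theorem1p2:
  fixes \<epsilon> :: real
  assumes "\<epsilon> > 0"
  shows "\<exists>(n0::nat) (\<delta>::real). \<delta> > 0 \<and>
    (\<forall>n \<ge> n0. \<forall>E. simple_graph n E \<and>
        real (num_cycle_copies 5 E) \<le> \<delta> * real n powr (5/2) \<and>
        real (num_cycle_copies 4 E) \<le> \<delta> * real n ^ 2
      \<longrightarrow> (\<exists>F \<subseteq> E. real (card F) \<le> \<epsilon> * real n powr (3/2) \<and>
             cycle_free 3 (E - F) \<and> cycle_free 5 (E - F)))"
proof -
  \<comment> \<open>Edges at vertices of degree above \<open>M * s\<close> number at most
    \<open>4 / M * n * s\<close>, and this value of \<open>M\<close> brings that below
    \<open>\<epsilon> / 2 * n * s\<close>.\<close>
  define M where "M = max 1 (8 / \<epsilon>)"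
  have M: "1 \<le> M" "8 / \<epsilon> \<le> M" by (auto simp: M_def)
  obtain n1 \<delta>1 where \<delta>1: "0 < \<delta>1" and core: "\<forall>(V::nat set) f. fin_graph V f \<longrightarrow> n1 \<le> card V \<longrightarrow>
    (\<forall>x\<in>V. (\<Sum>y\<in>V. f x y) \<le> M * sqrt (card V)) \<longrightarrow>
    fin_graph.C4_sum V f \<le> \<delta>1 * (real (card V))\<^sup>2 \<longrightarrow>
    real (card (fin_graph.cycle_lists V f 5)) \<le> \<delta>1 * sqrt (card V) ^ 5 \<longrightarrow>
    (\<exists>B. (\<Sum>x\<in>V. \<Sum>y\<in>V. if B x y then f x y else 0) \<le> \<epsilon> / 2 * card V * sqrt (card V) \<and>
      (\<forall>x0\<in>V. \<forall>x1\<in>V. \<forall>x2\<in>V. \<forall>x3\<in>V. \<forall>x4\<in>V. B x0 x1 \<or> B x1 x2 \<or> B x2 x3 \<or> B x3 x4 \<or> B x4 x0))"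
    using bounded_degree_hitting_set[where 'a = nat and \<epsilon> = "\<epsilon> / 2", OF _ M(1)] assms by auto
  \<comment> \<open>The factor 3125 is \<open>5 ^ 5\<close>, lost from copies to lists; 1024 is four
    times \<open>4 ^ 4\<close>, so that \<open>C4_sum\<close> is at most a quarter of
    \<open>n\<^sup>2\<close>.\<close>
  define \<delta> where "\<delta> = min (\<delta>1 / 3125) (1 / 1024)"
  have \<delta>: "0 < \<delta>" "3125 * \<delta> \<le> \<delta>1" "1024 * \<delta> \<le> 1" using \<delta>1 by (auto simp: \<delta>_def)
  show ?thesis
  proof (intro exI[of _ "max 1 n1"] exI[of _ \<delta>] conjI allI impI)
    show "0 < \<delta>" by fact
    fix n :: nat and E :: "nat set set"
    assume n: "max 1 n1 \<le> n" and "simple_graph n E \<and>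
        real (num_cycle_copies 5 E) \<le> \<delta> * real n powr (5/2) \<and>
        real (num_cycle_copies 4 E) \<le> \<delta> * real n ^ 2"
    then have E: "simple_graph n E" and N5: "real (num_cycle_copies 5 E) \<le> \<delta> * sqrt n ^ 5"
      and N4: "real (num_cycle_copies 4 E) \<le> \<delta> * (real n)\<^sup>2"
      by (auto simp: powr_five_halves)
    define V where "V = {..<n}"
    define s where "s = sqrt n"
    have cV: "card V = n" and finV: "finite V" by (simp_all add: V_def)
    have npos: "1 \<le> real n" using n by simp
    have spos: "0 < s" using npos by (simp add: s_def)
    have ss: "s * s = real n" by (simp add: s_def)
    have edge: "x \<in> V \<and> y \<in> V \<and> x \<noteq> y" if "{x, y} \<in> E" for x y
      using E that unfolding simple_graph_def V_def by (fastforce simp: doubleton_eq_iff)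
    have finE: "finite E"
    proof (rule finite_subset)
      show "E \<subseteq> Pow V" using E unfolding simple_graph_def V_def by auto
    qed (simp add: finV)
    define a where "a = (\<lambda>x y. if {x, y} \<in> E then 1 else (0::real))"
    define deg where "deg = (\<lambda>x. \<Sum>y\<in>V. a x y)"
    define f where "f = (\<lambda>x y. if deg x \<le> M * s \<and> deg y \<le> M * s then a x y else 0)"
    have asym: "a x y = a y x" for x y by (simp add: a_def insert_commute)
    have a0: "0 \<le> a x y" for x y by (simp add: a_def)
    interpret A: fin_graph V a
    proof
      show "a x x = 0" for x using edge[of x x] by (auto simp: a_def)
    qed (use finV asym in \<open>auto simp: a_def\<close>)
    interpret F: fin_graph V f
      by unfold_locales (use finV A.irrefl asym in \<open>auto simp: f_def a_def\<close>)
    have count: "real (card (A.cycle_lists k)) \<le> real (k ^ k) * num_cycle_copies k E" for k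
    proof -
      have sub: "A.cycle_lists k \<subseteq> {xs. length xs = k \<and> distinct xs \<and> cycle_edges xs \<subseteq> E}"
        unfolding A.cycle_lists_def unfolding cycle_edges_def a_def by (auto split: if_splits)
      have "finite {xs. length xs = k \<and> distinct xs \<and> cycle_edges xs \<subseteq> E}"
      proof (rule finite_subset)
        show "{xs. length xs = k \<and> distinct xs \<and> cycle_edges xs \<subseteq> E} \<subseteq> {xs. set xs \<subseteq> \<Union>E \<and> length xs = k}"
          by (simp only: Union_cycle_edges[symmetric]) blast
        have "\<Union>E \<subseteq> V" using E unfolding simple_graph_def V_def by fastforce
        then show "finite {xs. set xs \<subseteq> \<Union>E \<and> length xs = k}"
          using finV by (intro finite_lists_length_eq) (auto intro: finite_subset)
      qed
      then have "card (A.cycle_lists k) \<le> k ^ k * num_cycle_copies k E"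
        using card_mono[OF _ sub] card_cycle_edge_lists_le[OF finE, of k] by linarith
      then show ?thesis by (simp only: of_nat_le_iff of_nat_mult[symmetric])
    qed
    have sub: "F.cycle_lists k \<subseteq> A.cycle_lists k" for k
    proof -
      have "f x y = 1 \<Longrightarrow> a x y = 1" for x y by (simp add: f_def split: if_splits)
      then show ?thesis unfolding F.cycle_lists_def A.cycle_lists_def by blast
    qed
    have "real (card (A.cycle_lists 4)) \<le> 256 * (\<delta> * (real n)\<^sup>2)"
      using count[of 4] N4 by simp
    then have AC4: "A.C4_sum \<le> 256 * \<delta> * (real n)\<^sup>2"
      and FC4: "F.C4_sum \<le> 256 * \<delta> * (real n)\<^sup>2"
      using A.C4_sum_le_card F.C4_sum_le_card card_mono[OF A.finite_cycle_lists sub, of 4] by simp_all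
    have "real (card (F.cycle_lists 5)) \<le> real (card (A.cycle_lists 5))"
      using card_mono[OF A.finite_cycle_lists sub, of 5] by simp
    also have "\<dots> \<le> 3125 * (\<delta> * s ^ 5)" using count[of 5] N5 by (simp add: s_def)
    also have "\<dots> = (3125 * \<delta>) * s ^ 5" by simp
    also have "\<dots> \<le> \<delta>1 * s ^ 5" using \<delta> spos by (intro mult_right_mono) auto
    finally have FC5: "real (card (F.cycle_lists 5)) \<le> \<delta>1 * s ^ 5" .
    have "256 * \<delta> * (real n)\<^sup>2 \<le> \<delta>1 * (real n)\<^sup>2" using \<delta> by (intro mult_right_mono) auto
    then have FC4': "F.C4_sum \<le> \<delta>1 * (real n)\<^sup>2" using FC4 by simp
    have Fdeg: "(\<Sum>y\<in>V. f x y) \<le> M * s" for x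
    proof (cases "deg x \<le> M * s")
      case True
      have "(\<Sum>y\<in>V. f x y) \<le> deg x" unfolding deg_def f_def by (intro sum_mono) (simp add: a0)
      then show ?thesis using True by simp
    next
      case False
      then show ?thesis using M spos by (simp add: f_def)
    qed
    have "\<exists>B. (\<Sum>x\<in>V. \<Sum>y\<in>V. if B x y then f x y else 0) \<le> \<epsilon> / 2 * card V * sqrt (card V) \<and>
      (\<forall>x0\<in>V. \<forall>x1\<in>V. \<forall>x2\<in>V. \<forall>x3\<in>V. \<forall>x4\<in>V. B x0 x1 \<or> B x1 x2 \<or> B x2 x3 \<or> B x3 x4 \<or> B x4 x0)"
      by (rule core[rule_format, OF F.fin_graph_axioms])
         (use n Fdeg FC4' FC5 in \<open>simp_all add: cV s_def\<close>)
    then obtain B where B: "(\<Sum>x\<in>V. \<Sum>y\<in>V. if B x y then f x y else 0) \<le> \<epsilon> / 2 * card V * sqrt (card V) \<and>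
      (\<forall>x0\<in>V. \<forall>x1\<in>V. \<forall>x2\<in>V. \<forall>x3\<in>V. \<forall>x4\<in>V. B x0 x1 \<or> B x1 x2 \<or> B x2 x3 \<or> B x3 x4 \<or> B x4 x0)" ..
    have Bsum: "(\<Sum>x\<in>V. \<Sum>y\<in>V. if B x y then f x y else 0) \<le> \<epsilon> / 2 * n * s"
      using B by (simp add: cV s_def)
    note Bhit = conjunct2[OF B, rule_format]
    have degsq: "(\<Sum>x\<in>V. (deg x)\<^sup>2) \<le> 4 * (real n)\<^sup>2"
    proof -
      have "(\<Sum>y\<in>V. (\<Sum>x\<in>V. a x y)\<^sup>2) = (\<Sum>x\<in>V. (deg x)\<^sup>2)"
        unfolding deg_def by (intro sum.cong refl) (simp add: asym)
      then have le: "(\<Sum>x\<in>V. (deg x)\<^sup>2) \<le> (real n)\<^sup>2 + A.C4_sum + (\<Sum>x\<in>V. deg x)"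
        using A.sum_degree_square[of V] by (simp add: cV deg_def)
      \<comment> \<open>The linear term is absorbed into half of the left-hand side, so no bound on
        the number of edges is needed beforehand.\<close>
      have "(\<Sum>x\<in>V. deg x) \<le> (\<Sum>x\<in>V. (deg x)\<^sup>2 / 2 + 1 / 2)"
      proof (rule sum_mono)
        fix x
        have "0 \<le> (deg x - 1)\<^sup>2" by simp
        then show "deg x \<le> (deg x)\<^sup>2 / 2 + 1 / 2" by (simp add: power2_eq_square algebra_simps)
      qed
      also have "\<dots> = (\<Sum>x\<in>V. (deg x)\<^sup>2) / 2 + n / 2"
        by (simp add: sum.distrib sum_divide_distrib cV)
      finally have "(\<Sum>x\<in>V. deg x) \<le> (\<Sum>x\<in>V. (deg x)\<^sup>2) / 2 + n / 2" .
      moreover have "256 * \<delta> * (real n)\<^sup>2 \<le> 1 / 4 * (real n)\<^sup>2" using \<delta> by (intro mult_right_mono) auto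
      moreover have "real n \<le> (real n)\<^sup>2" using npos by (simp add: power2_eq_square)
      ultimately show ?thesis using le AC4 by linarith
    qed
    have high: "(\<Sum>x\<in>V. \<Sum>y\<in>V. if M * s < deg x then a x y else 0) \<le> \<epsilon> / 2 * n * s"
    proof -
      have Ms: "0 < M * s" using M spos by simp
      have "(\<Sum>x\<in>V. \<Sum>y\<in>V. if M * s < deg x then a x y else 0) \<le> (\<Sum>x\<in>V. (deg x)\<^sup>2 / (M * s))"
      proof (rule sum_mono)
        fix x
        show "(\<Sum>y\<in>V. if M * s < deg x then a x y else 0) \<le> (deg x)\<^sup>2 / (M * s)"
        proof (cases "M * s < deg x")
          case True
          then have "M * s * deg x \<le> (deg x)\<^sup>2" using Ms by (simp add: power2_eq_square)
          then have "deg x \<le> (deg x)\<^sup>2 / (M * s)"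
            by (subst pos_le_divide_eq[OF Ms]) (simp only: mult.commute[of "deg x"])
          then show ?thesis using True by (simp add: deg_def)
        next
          case False
          then show ?thesis using Ms by simp
        qed
      qed
      also have "\<dots> = (\<Sum>x\<in>V. (deg x)\<^sup>2) / (M * s)" by (simp add: sum_divide_distrib)
      also have "\<dots> \<le> 4 * (real n)\<^sup>2 / (M * s)" using degsq Ms by (intro divide_right_mono) auto
      also have "\<dots> = (4 / M) * n * s"
        unfolding ss[symmetric] using spos by (simp add: power2_eq_square)
      also have "\<dots> \<le> (\<epsilon> / 2) * n * s"
      proof -
        have "8 \<le> M * \<epsilon>" using M(2) assms by (simp add: pos_divide_le_eq)
        then have "4 / M \<le> \<epsilon> / 2" using M(1) by (simp add: field_simps)
        then show ?thesis using spos by (intro mult_right_mono) auto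
      qed
      finally show ?thesis .
    qed
    \<comment> \<open>\<open>B\<close> and the degree condition are not symmetric, so ordered pairs
      are collected; an edge is deleted as soon as one of its orientations is in
      \<open>D\<close>.\<close>
    define D where "D = {(x, y) \<in> V \<times> V. a x y = 1 \<and> (M * s < deg x \<or> B x y \<and> f x y = 1)}"
    define F where "F = (\<lambda>(x, y). {x, y}) ` D"
    have finD: "finite D" by (rule finite_subset[of _ "V \<times> V"]) (auto simp: D_def finV)
    have FE: "F \<subseteq> E" by (auto simp: F_def D_def a_def split: if_splits)
    have "real (card F) \<le> real (card D)" unfolding F_def using card_image_le[OF finD] by simp
    also have "\<dots> = (\<Sum>(x, y)\<in>V \<times> V. if (x, y) \<in> D then 1 else 0)"
    proof -
      have "D = {p \<in> V \<times> V. p \<in> D}" by (auto simp: D_def)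
      then have "real (card D) = (\<Sum>p\<in>V \<times> V. if p \<in> D then 1 else 0)"
        using finV by (simp add: sum.inter_filter[symmetric])
      then show ?thesis by (simp add: case_prod_unfold)
    qed
    also have "\<dots> = (\<Sum>x\<in>V. \<Sum>y\<in>V. if (x, y) \<in> D then 1 else 0)"
      by (rule sum.cartesian_product[symmetric])
    also have "\<dots> \<le> (\<Sum>x\<in>V. \<Sum>y\<in>V. (if M * s < deg x then a x y else 0) + (if B x y then f x y else 0))"
      by (intro sum_mono) (auto simp: D_def a0 F.f_nonneg)
    also have "\<dots> \<le> \<epsilon> / 2 * n * s + \<epsilon> / 2 * n * s"
      unfolding sum.distrib using high Bsum by linarith
    also have "\<dots> = \<epsilon> * real n powr (3/2)" by (simp add: powr_three_halves s_def)
    finally have cF: "real (card F) \<le> \<epsilon> * real n powr (3/2)" .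
    have kept: "\<not> B x y" if "{x, y} \<in> E - F" for x y
    proof
      assume B: "B x y"
      have V: "x \<in> V" "y \<in> V" and axy: "a x y = 1" using that edge by (auto simp: a_def)
      \<comment> \<open>Both orientations survive, so both endpoints have low degree and the edge is
        present in \<open>f\<close>.\<close>
      have nD: "(x, y) \<notin> D" "(y, x) \<notin> D" using that by (force simp: F_def insert_commute)+
      have "deg x \<le> M * s" "deg y \<le> M * s"
        using nD V axy asym[of x y] by (auto simp: D_def not_less)
      then have "f x y = 1" using axy by (simp add: f_def)
      then show False using nD(1) V axy B by (auto simp: D_def)
    qed
    have free3: "cycle_free 3 (E - F)"
    proof (unfold cycle_free_def cycle_copies_def, safe)
      fix xs :: "nat list" assume xs: "cycle_edges xs \<subseteq> E - F" "length xs = 3" "distinct xs"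
      then obtain x y z where xyz: "xs = [x, y, z]"
        by (auto simp: numeral_eq_Suc length_Suc_conv)
      have "{xs ! i, xs ! ((i + 1) mod length xs)} \<in> cycle_edges xs" if "i < 3" for i
        unfolding cycle_edges_def xs(2) using that by blast
      note e = this[THEN subsetD[OF xs(1)]]
      from e[of 0] e[of 1] e[of 2]
      have ed: "{x, y} \<in> E - F" "{y, z} \<in> E - F" "{z, x} \<in> E - F" by (simp_all add: xyz)
      \<comment> \<open>The closed walk \<open>x y z y z\<close> traverses this edge in both
        directions.\<close>
      then have "{z, y} \<in> E - F" by (simp add: insert_commute)
      moreover have "x \<in> V" "y \<in> V" "z \<in> V" using ed edge by blast+
      ultimately have False
        using Bhit[of x y z y z] kept[OF ed(1)] kept[OF ed(2)] kept[of z y] kept[OF ed(3)] by blast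
      then show "cycle_edges xs \<in> {}" ..
    qed
    have free5: "cycle_free 5 (E - F)"
    proof (unfold cycle_free_def cycle_copies_def, safe)
      fix xs :: "nat list" assume xs: "cycle_edges xs \<subseteq> E - F" "length xs = 5" "distinct xs"
      then obtain x y z u v where xyz: "xs = [x, y, z, u, v]"
        by (auto simp: numeral_eq_Suc length_Suc_conv)
      have "{xs ! i, xs ! ((i + 1) mod length xs)} \<in> cycle_edges xs" if "i < 5" for i
        unfolding cycle_edges_def xs(2) using that by blast
      note e = this[THEN subsetD[OF xs(1)]]
      from e[of 0] e[of 1] e[of 2] e[of 3] e[of 4]
      have ed: "{x, y} \<in> E - F" "{y, z} \<in> E - F" "{z, u} \<in> E - F" "{u, v} \<in> E - F" "{v, x} \<in> E - F"
        by (simp_all add: xyz)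
      moreover have "x \<in> V" "y \<in> V" "z \<in> V" "u \<in> V" "v \<in> V" using ed edge by blast+
      ultimately have False
        using Bhit[of x y z u v] kept[OF ed(1)] kept[OF ed(2)] kept[OF ed(3)] kept[OF ed(4)] kept[OF ed(5)]
        by blast
      then show "cycle_edges xs \<in> {}" ..
    qed
    show "\<exists>F \<subseteq> E. real (card F) \<le> \<epsilon> * real n powr (3/2) \<and>
             cycle_free 3 (E - F) \<and> cycle_free 5 (E - F)"
      using FE cF free3 free5 by blast
  qed
qed

end
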